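(* Let $d\ge2$, let $F_d$ be the free group on $a_1,\dots,a_d$ with boundary $\partial F_d$, and let $f:(0,\infty)\to\mathbb{R}$ be a smooth strictly convex function with $f(1)=0$. Then for every $\lambda\in\Delta_d$, $$I^{top}_{\lambda,f}(\partial F_d)=h_{\lambda,f}(\partial F_d,\nu_\mu),\qquad\text{where }\mu=T^{-1}(\lambda),$$ $T:\Delta_d\to\Delta_d$ is the bijection attached to $f$ defined in the context, and $\nu_\mu$ is the $\mu$-harmonic measure on $\partial F_d$.
   Context: Write $a_{-i}=a_i^{-1}$. $\Delta_d$ is the set of generating symmetric probability measures on $F_d$ supported on $\{a_{\pm1},\dots,a_{\pm d}\}$ (generating: the support generates $F_d$). The boundary $\partial F_d$ is the compact metrizable space of infinite reduced words in $a_{\pm1},\dots,a_{\pm d}$ with the natural continuous $F_d$-action. The $\mu$-harmonic measure $\nu_\mu$ is the $\mu$-stationary ($\mu*\nu_\mu=\nu_\mu$) Borel probability measure on $\partial F_d$. Definition of $T$: for $\mu\in\Delta_d$ put $p_i=\mu(a_i)$, $i\in\{\pm1,\dots,\pm d\}$. There are unique numbers $q_i\in(0,1)$ with $q_j=p_j+q_j\sum_{i\ne j}p_iq_{-i}$ for all $j$ (sum over $i\in\{\pm1,\dots,\pm d\}\setminus\{j\}$), and they satisfy $q_i=q_{-i}$. Put $\Psi_f(z)=f(z)-zf'(z)+f'(1/z)$. Then $T(\mu)=\lambda\in\Delta_d$ is given by $$\lambda(a_{\pm j})=\frac{c}{\Psi_f(q_j)-\Psi_f(1/q_j)},\qquad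 c=\Big(2\sum_{i=1}^d\frac1{\Psi_f(q_i)-\Psi_f(1/q_i)}\Big)^{-1}.$$ It is known from earlier work that $T:\Delta_d\to\Delta_d$ is a bijection. Entropy: for probability measures $P,Q$ on a Borel space, choose a measure $R$ with $P,Q\ll R$, put $p=\frac{dP}{dR}$, $q=\frac{dQ}{dR}$, $f'(\infty)=\lim_{t\to\infty}f(t)/t$, $f(0)=f(0^+)$, and define (independently of $R$, with $0\cdot\infty=0$) $D_f(P\|Q)=\int_{\{q>0\}}f(p/q)\,q\,dR+P(\{q=0\})f'(\infty)$. For a Borel probability measure $\nu$ on $\partial F_d$, $h_{\lambda,f}(\partial F_d,\nu)=\sum_{g}\lambda(g)D_f(g\nu\|\nu)$, where $g\nu$ is the push-forward, and $I^{top}_{\lambda,f}(\partial F_d)=\inf_\nu h_{\lambda,f}(\partial F_d,\nu)$ over all Borel probability measures $\nu$ on $\partial F_d$.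
   Formalization: Proved for all λ, μ in Δ_d with T(μ)=λ; that T is onto is not claimed, since it fails for some f when d≥3 (e.g. f(t)=e^{-t}-e^{-1}, d=3, λ(a_1) tiny, λ(a_2)=λ(a_3)), where T^{-1}(λ) does not exist. *)

theory Defs
  imports "HOL-Probability.Probability" "HOL-Algebra.Generated_Groups"
begin

text \<open>
  The letter \<open>i\<close> with \<open>1 \<le> \<bar>i\<bar> \<le> d\<close> stands for the generator \<open>a\<^sub>i\<close> of the free group of rank
  \<open>d\<close>, where \<open>a\<close> with index \<open>-i\<close> is the inverse of \<open>a\<^sub>i\<close>.  Group elements are finite reduced words,
  boundary points are infinite reduced words.
\<close>

definition letters :: "nat \<Rightarrow> int set" where
  "letters d = {i. i \<noteq> 0 \<and> \<bar>i\<bar> \<le> int d}"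

definition reduced :: "int list \<Rightarrow> bool" where
  "reduced w \<longleftrightarrow> (\<forall>n. Suc n < length w \<longrightarrow> w ! Suc n \<noteq> - (w ! n))"

definition mult_letter :: "int \<Rightarrow> int list \<Rightarrow> int list" where
  "mult_letter a w = (if w \<noteq> [] \<and> hd w = - a then tl w else a # w)"

definition free_grp :: "nat \<Rightarrow> int list monoid" where
  "free_grp d = \<lparr>carrier = {w. set w \<subseteq> letters d \<and> reduced w},
                 mult = (\<lambda>v w. foldr mult_letter v w), one = []\<rparr>"

lemma reduced_Nil: "reduced []"
  by (simp add: reduced_def)

lemma reduced_Cons: "reduced (a # w) \<longleftrightarrow> reduced w \<and> (w = [] \<or> hd w \<noteq> - a)"
  by (cases w) (auto simp: reduced_def nth_Cons split: nat.splits)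

lemma mult_letter_cancel:
  assumes "reduced w" "b = - a" shows "mult_letter a (mult_letter b w) = w"
  using assms by (cases w; cases "tl w") (auto simp: mult_letter_def reduced_Cons)

lemma mult_letter_carrier:
  assumes "a \<in> letters d" "w \<in> carrier (free_grp d)"
  shows "mult_letter a w \<in> carrier (free_grp d)"
  using assms by (cases w) (auto simp: mult_letter_def free_grp_def reduced_Cons reduced_Nil)

lemma foldr_carrier:
  assumes "set v \<subseteq> letters d" "w \<in> carrier (free_grp d)"
  shows "foldr mult_letter v w \<in> carrier (free_grp d)"
  using assms by (induction v) (auto simp: mult_letter_carrier)

lemma foldr_mult_letter:
  assumes "a \<in> letters d" "w \<in> carrier (free_grp d)" "z \<in> carrier (free_grp d)"
  shows "foldr mult_letter (mult_letter a w) z = mult_letter a (foldr mult_letter w z)"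
proof (cases "w \<noteq> [] \<and> hd w = - a")
  case True
  then obtain w' where w: "w = - a # w'" by (cases w) auto
  have "foldr mult_letter w' z \<in> carrier (free_grp d)"
    using assms w by (intro foldr_carrier) (auto simp: free_grp_def)
  then have "reduced (foldr mult_letter w' z)" by (simp add: free_grp_def)
  then show ?thesis by (simp add: w mult_letter_cancel) (simp add: mult_letter_def)
qed (auto simp: mult_letter_def)

lemma foldr_assoc:
  assumes "set u \<subseteq> letters d" "v \<in> carrier (free_grp d)" "w \<in> carrier (free_grp d)"
  shows "foldr mult_letter (foldr mult_letter u v) w = foldr mult_letter u (foldr mult_letter v w)"
  using assms(1)
proof (induction u)
  case (Cons a u)
  then have "foldr mult_letter u v \<in> carrier (free_grp d)" by (intro foldr_carrier assms) auto
  with Cons show ?case using foldr_mult_letter[of a d _ w] assms by simp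
qed simp

lemma foldr_Nil: "reduced w \<Longrightarrow> foldr mult_letter w [] = w"
  by (induction w) (auto simp: reduced_Cons mult_letter_def)

lemma left_inverse_word:
  assumes "w \<in> carrier (free_grp d)"
  shows "\<exists>v \<in> carrier (free_grp d). foldr mult_letter v w = []"
proof -
  define v where "v = foldr mult_letter (rev (map uminus w)) []"
  have nil: "[] \<in> carrier (free_grp d)" by (simp add: free_grp_def reduced_Nil)
  have set: "set (rev (map uminus w)) \<subseteq> letters d"
    using assms by (auto simp: free_grp_def letters_def)
  have "foldr mult_letter (rev (map uminus w)) w = []"
    using assms unfolding free_grp_def
    by (induction w) (auto simp: reduced_Cons mult_letter_def)
  then have "foldr mult_letter v w = []"
    unfolding v_def using foldr_assoc[OF set nil assms] by simp
  with foldr_carrier[OF set nil] show ?thesis unfolding v_def by blast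
qed

lemma group_free_grp: "group (free_grp d)"
proof (rule groupI)
  fix x y assume "x \<in> carrier (free_grp d)" "y \<in> carrier (free_grp d)"
  then show "x \<otimes>\<^bsub>free_grp d\<^esub> y \<in> carrier (free_grp d)"
    using foldr_carrier[of x d y] by (simp add: free_grp_def)
next
  fix x y z
  assume "x \<in> carrier (free_grp d)" "y \<in> carrier (free_grp d)" "z \<in> carrier (free_grp d)"
  then show "x \<otimes>\<^bsub>free_grp d\<^esub> y \<otimes>\<^bsub>free_grp d\<^esub> z = x \<otimes>\<^bsub>free_grp d\<^esub> (y \<otimes>\<^bsub>free_grp d\<^esub> z)"
    using foldr_assoc[of x d y z] by (simp add: free_grp_def)
next
  fix x assume "x \<in> carrier (free_grp d)"
  then show "\<exists>y \<in> carrier (free_grp d). y \<otimes>\<^bsub>free_grp d\<^esub> x = \<one>\<^bsub>free_grp d\<^esub>"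
    using left_inverse_word[of x d] by (simp add: free_grp_def)
qed (auto simp: free_grp_def reduced_Nil)

definition boundary :: "nat \<Rightarrow> (nat \<Rightarrow> int) set" where
  "boundary d = {\<xi>. (\<forall>n. \<xi> n \<in> letters d) \<and> (\<forall>n. \<xi> (Suc n) \<noteq> - \<xi> n)}"

text \<open>Below, \<^term>\<open>borel\<close> refers to the product topology on sequences of (discrete) integers.\<close>

definition boundary_borel :: "nat \<Rightarrow> (nat \<Rightarrow> int) measure" where
  "boundary_borel d = restrict_space borel (boundary d)"

definition act_letter :: "int \<Rightarrow> (nat \<Rightarrow> int) \<Rightarrow> (nat \<Rightarrow> int)" where
  "act_letter a \<xi> = (if \<xi> 0 = - a then (\<lambda>n. \<xi> (Suc n)) else case_nat a \<xi>)"

definition act :: "int list \<Rightarrow> (nat \<Rightarrow> int) \<Rightarrow> (nat \<Rightarrow> int)" where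
  "act g \<xi> = foldr act_letter g \<xi>"

definition translate :: "nat \<Rightarrow> int list \<Rightarrow> (nat \<Rightarrow> int) measure \<Rightarrow> (nat \<Rightarrow> int) measure" where
  "translate d g \<nu> = distr \<nu> (boundary_borel d) (act g)"

definition boundary_probs :: "nat \<Rightarrow> (nat \<Rightarrow> int) measure set" where
  "boundary_probs d = {\<nu>. prob_space \<nu> \<and> sets \<nu> = sets (boundary_borel d)}"

definition Delta :: "nat \<Rightarrow> int list pmf set" where
  "Delta d = {\<mu>. set_pmf \<mu> \<subseteq> (\<lambda>i. [i]) ` letters d \<and>
                 (\<forall>g \<in> carrier (free_grp d). pmf \<mu> (inv\<^bsub>free_grp d\<^esub> g) = pmf \<mu> g) \<and>
                 generate (free_grp d) (set_pmf \<mu>) = carrier (free_grp d)}"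

text \<open>The second conjunct says that \<open>\<nu>\<close> equals the convolution of \<open>\<mu>\<close> and \<open>\<nu>\<close>.\<close>

definition stationary :: "nat \<Rightarrow> int list pmf \<Rightarrow> (nat \<Rightarrow> int) measure \<Rightarrow> bool" where
  "stationary d \<mu> \<nu> \<longleftrightarrow> \<nu> \<in> boundary_probs d \<and>
     (\<forall>A \<in> sets (boundary_borel d).
        (\<integral>\<^sup>+ g. emeasure (translate d g \<nu>) A \<partial>measure_pmf \<mu>) = emeasure \<nu> A)"

definition harmonic_measure :: "nat \<Rightarrow> int list pmf \<Rightarrow> (nat \<Rightarrow> int) measure" where
  "harmonic_measure d \<mu> = (THE \<nu>. stationary d \<mu> \<nu>)"

definition smooth_pos :: "(real \<Rightarrow> real) \<Rightarrow> bool" where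
  "smooth_pos f \<longleftrightarrow> (\<forall>n. \<forall>x>0. (deriv ^^ n) f field_differentiable (at x))"

definition strictly_convex_pos :: "(real \<Rightarrow> real) \<Rightarrow> bool" where
  "strictly_convex_pos f \<longleftrightarrow>
     (\<forall>x>0. \<forall>y>0. \<forall>t. x \<noteq> y \<longrightarrow> 0 < t \<longrightarrow> t < 1 \<longrightarrow>
        f ((1 - t) * x + t * y) < (1 - t) * f x + t * f y)"

text \<open>
  The numbers \<open>q\<^sub>i\<close>; \<open>\<rightarrow>\<^sub>E\<close> makes the function unique by fixing its values outside
  the index set.
\<close>

definition hitting :: "nat \<Rightarrow> int list pmf \<Rightarrow> int \<Rightarrow> real" where
  "hitting d \<mu> = (THE q. q \<in> letters d \<rightarrow>\<^sub>E {0<..<1} \<and>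
     (\<forall>j \<in> letters d. q j = pmf \<mu> [j] + q j * (\<Sum>i \<in> letters d - {j}. pmf \<mu> [i] * q (- i))))"

definition Psi :: "(real \<Rightarrow> real) \<Rightarrow> real \<Rightarrow> real" where
  "Psi f z = f z - z * deriv f z + deriv f (1 / z)"

definition T_weight :: "nat \<Rightarrow> (real \<Rightarrow> real) \<Rightarrow> int list pmf \<Rightarrow> int \<Rightarrow> real" where
  "T_weight d f \<mu> j = 1 / (Psi f (hitting d \<mu> j) - Psi f (1 / hitting d \<mu> j))"

definition T_const :: "nat \<Rightarrow> (real \<Rightarrow> real) \<Rightarrow> int list pmf \<Rightarrow> real" where
  "T_const d f \<mu> = inverse (2 * (\<Sum>i = 1..int d. T_weight d f \<mu> i))"

definition T_map :: "nat \<Rightarrow> (real \<Rightarrow> real) \<Rightarrow> int list pmf \<Rightarrow> int list pmf" where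
  "T_map d f \<mu> = embed_pmf (\<lambda>w. if w \<in> (\<lambda>i. [i]) ` letters d
     then T_const d f \<mu> * T_weight d f \<mu> \<bar>hd w\<bar> else 0)"

text \<open>
  Values in \<^typ>\<open>ereal\<close> are needed: \<open>f(0\<^sup>+)\<close>, \<open>f'(\<infinity>)\<close> and the divergence may be \<open>+\<infinity>\<close>.
\<close>

definition f_ext :: "(real \<Rightarrow> real) \<Rightarrow> real \<Rightarrow> ereal" where
  "f_ext f t = (if t > 0 then ereal (f t) else Lim (at_right 0) (\<lambda>s. ereal (f s)))"

definition f_slope_inf :: "(real \<Rightarrow> real) \<Rightarrow> ereal" where
  "f_slope_inf f = Lim at_top (\<lambda>t. ereal (f t / t))"

text \<open>
  Lebesgue integral of a quasi-integrable extended real function.  In the divergence below the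
  negative part is integrable, since a convex \<open>f\<close> has an affine minorant.
\<close>

definition ereal_integral :: "'a measure \<Rightarrow> ('a \<Rightarrow> ereal) \<Rightarrow> ereal" where
  "ereal_integral M u =
     enn2ereal (\<integral>\<^sup>+ x. e2ennreal (u x) \<partial>M) - enn2ereal (\<integral>\<^sup>+ x. e2ennreal (- u x) \<partial>M)"

definition f_divergence_wrt ::
  "'a measure \<Rightarrow> (real \<Rightarrow> real) \<Rightarrow> 'a measure \<Rightarrow> 'a measure \<Rightarrow> ereal" where
  "f_divergence_wrt R f P Q =
     (let p = (\<lambda>x. enn2real (RN_deriv R P x)); q = (\<lambda>x. enn2real (RN_deriv R Q x)) in
        ereal_integral R (\<lambda>x. if q x > 0 then f_ext f (p x / q x) * ereal (q x) else 0)
        + enn2ereal (emeasure P {x \<in> space P. q x = 0}) * f_slope_inf f)"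

definition f_divergence :: "(real \<Rightarrow> real) \<Rightarrow> 'a measure \<Rightarrow> 'a measure \<Rightarrow> ereal" where
  "f_divergence f P Q =
     f_divergence_wrt (SOME R. sigma_finite_measure R \<and> sets R = sets P \<and>
                               absolutely_continuous R P \<and> absolutely_continuous R Q) f P Q"

definition h_entropy :: "nat \<Rightarrow> int list pmf \<Rightarrow> (real \<Rightarrow> real) \<Rightarrow> (nat \<Rightarrow> int) measure \<Rightarrow> ereal" where
  "h_entropy d lam f \<nu> =
     (\<Sum>\<^sub>\<infinity>g \<in> carrier (free_grp d). ereal (pmf lam g) * f_divergence f (translate d g \<nu>) \<nu>)"

definition I_top :: "nat \<Rightarrow> int list pmf \<Rightarrow> (real \<Rightarrow> real) \<Rightarrow> ereal" where
  "I_top d lam f = (INF \<nu> \<in> boundary_probs d. h_entropy d lam f \<nu>)"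

end

theory Submission
  imports Defs
begin

text \<open>
  Fix \<open>\<mu>\<close> and let \<open>q\<^sub>j\<close> be its hitting probabilities.  The harmonic measure \<open>\<nu>\<^sub>\<mu>\<close> satisfies
  \<open>\<nu>\<^sub>\<mu>(a\<^sub>j A) = q\<^sub>j \<nu>\<^sub>\<mu>(A)\<close> for every set \<open>A\<close> of words that do not begin with \<open>a\<^sub>j\<close> inverse.  Since
  \<open>q\<close> is symmetric, the density \<open>r\<^sub>j\<close> of \<open>a\<^sub>j \<nu>\<^sub>\<mu>\<close> with respect to \<open>\<nu>\<^sub>\<mu>\<close> takes two values: it is
  \<open>1/q\<^sub>j\<close> on the cylinder \<open>C\<^sub>j\<close> of words beginning with \<open>a\<^sub>j\<close>, and \<open>q\<^sub>j\<close> elsewhere.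

  Integrating the tangent inequality \<open>f(t) \<ge> f(r) + f'(r) (t - r)\<close> with \<open>r = r\<^sub>j\<close> gives, for every
  probability measure \<open>\<nu>\<close> on the boundary, the lower bound
  \<open>\<integral> f'(r\<^sub>j) d(a\<^sub>j\<nu>) + \<integral> (f(r\<^sub>j) - r\<^sub>j f'(r\<^sub>j)) d\<nu>\<close> for the divergence of \<open>a\<^sub>j\<nu>\<close> from \<open>\<nu>\<close>, with
  equality for \<open>\<nu> = \<nu>\<^sub>\<mu>\<close> (lemmas \<open>f_divergence_ge\<close> and \<open>f_divergence_density\<close>).  As \<open>r\<^sub>j\<close> is constant on
  \<open>C\<^sub>j\<close> and on its complement, the bound depends only on the masses \<open>x\<^sub>i = \<nu>(C\<^sub>i)\<close>.  In the
  \<open>\<lambda>\<close>-weighted sum over \<open>j\<close> the terms odd under \<open>j \<mapsto> -j\<close> cancel and \<open>x\<^sub>j\<close> gets the coefficient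
  \<open>-\<lambda>\<^sub>j (\<Psi>(q\<^sub>j) - \<Psi>(1/q\<^sub>j))\<close>.  The definition of \<open>T\<close> says exactly that this is a constant \<open>-c\<close>.  Because
  the \<open>x\<^sub>j\<close> add up to \<open>1\<close>, the entropy of every \<open>\<nu>\<close> is at least \<open>\<Sum> \<lambda>\<^sub>j \<Psi>(q\<^sub>j) - c\<close>, a number that does
  not depend on \<open>\<nu>\<close> and that \<open>\<nu>\<^sub>\<mu>\<close> attains (lemma \<open>sum_entropy_bound\<close>).

  What remains is to identify the objects defined by unique description.  The equations for \<open>q\<close>
  reduce to one equation for the scalar \<open>1 - \<Sum> p\<^sub>i q\<^sub>i\<close> (\<open>hitting_solution_hitting\<close>); a measure with the
  above scaling property is built as the law of a Markov chain of letters (\<open>conformal_exists\<close>) and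
  is stationary by the equations for \<open>q\<close> (\<open>stationary_conformal\<close>); and stationary measures are unique by a
  maximum principle on words (\<open>stationary_unique\<close>).
\<close>

section \<open>Convex functions on the positive half-line\<close>

lemma tendsto_SUP_at_top:
  fixes g :: "real \<Rightarrow> ereal"
  assumes mono: "\<And>s t. a \<le> s \<Longrightarrow> s \<le> t \<Longrightarrow> g s \<le> g t"
  shows "(g \<longlongrightarrow> (SUP t\<in>{a..}. g t)) at_top"
proof (rule order_tendstoI)
  fix y assume "y < (SUP t\<in>{a..}. g t)"
  then obtain s where s: "a \<le> s" "y < g s" by (auto simp: less_SUP_iff)
  show "\<forall>\<^sub>F t in at_top. y < g t"
    using eventually_ge_at_top[of s] by eventually_elim (use s mono in \<open>blast intro: less_le_trans\<close>)
next
  fix y assume y: "y > (SUP t\<in>{a..}. g t)"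
  show "\<forall>\<^sub>F t in at_top. g t < y"
    using eventually_ge_at_top[of a]
    by eventually_elim (use y in \<open>auto intro: le_less_trans[OF SUP_upper]\<close>)
qed

text \<open>
  The functions that generate divergences; their values off the positive half-line play no role.
\<close>

locale divergence_generator =
  fixes f :: "real \<Rightarrow> real"
  assumes smooth: "smooth_pos f" and strict: "strictly_convex_pos f"
begin

lemma has_deriv:
  assumes "0 < x" shows "(f has_real_derivative deriv f x) (at x)"
proof -
  have "(deriv ^^ 0) f field_differentiable (at x)"
    using smooth assms unfolding smooth_pos_def by blast
  then show ?thesis by (simp add: DERIV_deriv_iff_field_differentiable)
qed

lemma convex_on_pos: "convex_on {0<..} f"
proof (rule convex_onI)
  fix t x y :: real assume "0 < t" "t < 1" "x \<in> {0<..}" "y \<in> {0<..}"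
  then have "x \<noteq> y \<Longrightarrow> f ((1 - t) * x + t * y) < (1 - t) * f x + t * f y"
    using strict unfolding strictly_convex_pos_def by simp
  then show "f ((1 - t) *\<^sub>R x + t *\<^sub>R y) \<le> (1 - t) * f x + t * f y"
    by (cases "x = y") (simp_all add: algebra_simps)
qed (simp add: convex_real_interval)

lemma tangent_le:
  assumes "0 < x" "0 < y" shows "f x + deriv f x * (y - x) \<le> f y"
proof -
  have "deriv f x * (y - x) \<le> f y - f x"
  proof (rule convex_on_imp_above_tangent[OF convex_on_pos])
    show "connected {0::real<..}" by simp
    show "(f has_real_derivative deriv f x) (at x within {0<..})"
      using has_deriv[OF assms(1)] by (rule has_field_derivative_at_within)
  qed (use assms in \<open>simp_all add: interior_open\<close>)
  then show ?thesis by simp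
qed

lemma deriv_less:
  assumes "0 < x" "x < y" shows "deriv f x < deriv f y"
proof (rule ccontr)
  assume "\<not> deriv f x < deriv f y"
  then have le: "deriv f y \<le> deriv f x" by simp
  define m where "m = (x + y) / 2"
  have m: "0 < m" "x < m" "m < y" using assms by (auto simp: m_def)
  have "f ((1 - 1/2) * x + (1/2) * y) < (1 - 1/2) * f x + (1/2) * f y"
    using assms by (intro strict[unfolded strictly_convex_pos_def, rule_format]) simp_all
  moreover have "(1 - 1/2) * x + (1/2) * y = m" by (simp add: m_def field_simps)
  ultimately have "2 * f m < f x + f y" by simp
  moreover have "f x + deriv f x * (m - x) \<le> f m" using assms m by (intro tangent_le) auto
  moreover have "f y + deriv f y * (x - y) \<le> f x" using assms m by (intro tangent_le) auto
  moreover have "deriv f y * (y - x) \<le> deriv f x * (y - x)"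
    using le assms by (intro mult_right_mono) auto
  moreover have "deriv f x * (m - x) * 2 = deriv f x * (y - x)" by (simp add: m_def field_simps)
  ultimately show False by (simp add: algebra_simps)
qed

lemma deriv_mono: "0 < x \<Longrightarrow> x \<le> y \<Longrightarrow> deriv f x \<le> deriv f y"
  using deriv_less[of x y] by (cases "x = y") auto

lemma Psi_diff_pos:
  assumes "0 < q" "q < 1" shows "0 < Psi f q - Psi f (1 / q)"
proof -
  define y where "y = 1 / q"
  have "q * q < 1 * 1" using assms by (intro mult_strict_mono) auto
  then have y: "q < y" "0 < y" "q * y = 1" using assms by (auto simp: y_def field_simps)
  have "f y + deriv f y * (q - y) \<le> f q" using assms y by (intro tangent_le) auto
  moreover have "0 < (1 + q) * (deriv f y - deriv f q)"
    using assms y deriv_less[of q y] by (intro mult_pos_pos) auto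
  moreover have "1 / y = q" by (simp add: y_def)
  ultimately show ?thesis unfolding Psi_def y_def[symmetric] by (simp add: algebra_simps)
qed

text \<open>
  The limits in the definitions of \<open>f_slope_inf\<close> and \<open>f_ext\<close> exist by monotonicity, once
  a suitable affine function has been subtracted from \<open>f\<close>.
\<close>

lemma tendsto_f_slope_inf: "((\<lambda>t. ereal (f t / t)) \<longlongrightarrow> f_slope_inf f) at_top"
proof -
  \<comment> \<open>The tangent to \<open>f + k\<close> at \<open>1\<close> passes through the origin, so \<open>(f t + k) / t\<close> increases for \<open>t \<ge> 1\<close>.\<close>
  define k where "k = deriv f 1 - f 1"
  have mono: "(f s + k) / s \<le> (f t + k) / t" if "1 \<le> s" "s \<le> t" for s t
  proof -
    have "f s + deriv f s * (1 - s) \<le> f 1" "f s + deriv f s * (t - s) \<le> f t"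
      using that by (auto intro: tangent_le)
    moreover have "deriv f 1 \<le> deriv f s" using that by (intro deriv_mono) auto
    ultimately have 1: "0 \<le> s * deriv f s - f s - k" and 2: "f s + deriv f s * (t - s) \<le> f t"
      by (auto simp: k_def algebra_simps)
    have "0 \<le> (t - s) * (s * deriv f s - f s - k)" using 1 that by (intro mult_nonneg_nonneg) auto
    moreover have "s * (f s + deriv f s * (t - s)) \<le> s * f t" using 2 that by (intro mult_left_mono) auto
    ultimately have "(f s + k) * t \<le> (f t + k) * s" by (simp add: algebra_simps)
    then show ?thesis using that by (simp add: field_simps)
  qed
  have "((\<lambda>t. ereal ((f t + k) / t)) \<longlongrightarrow> (SUP t\<in>{1..}. ereal ((f t + k) / t))) at_top"
    by (rule tendsto_SUP_at_top) (use mono in auto)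
  moreover have "((\<lambda>t. ereal (- k / t)) \<longlongrightarrow> ereal 0) at_top"
    by (intro tendsto_ereal tendsto_divide_0[OF tendsto_const]
          filterlim_at_top_imp_at_infinity filterlim_ident)
  ultimately have "((\<lambda>t. ereal ((f t + k) / t) + ereal (- k / t)) \<longlongrightarrow>
      (SUP t\<in>{1..}. ereal ((f t + k) / t)) + ereal 0) at_top"
    by (intro tendsto_add_ereal_general1) auto
  then have "((\<lambda>t. ereal (f t / t)) \<longlongrightarrow> (SUP t\<in>{1..}. ereal ((f t + k) / t)) + ereal 0) at_top"
    by (simp add: add_divide_distrib)
  then show ?thesis unfolding f_slope_inf_def by (simp add: tendsto_Lim)
qed

lemma tendsto_f_ext_0: "((\<lambda>s. ereal (f s)) \<longlongrightarrow> f_ext f 0) (at_right 0)"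
proof -
  \<comment> \<open>This convex function has a critical point at \<open>1\<close>, hence decreases on \<open>(0, 1]\<close>.\<close>
  define e where "e s = f s - deriv f 1 * s" for s
  have anti: "e t \<le> e s" if "0 < s" "s \<le> t" "t \<le> 1" for s t
  proof -
    have "f t + deriv f t * (s - t) \<le> f s" using that by (intro tangent_le) auto
    moreover have "0 \<le> (deriv f 1 - deriv f t) * (t - s)"
      using that by (intro mult_nonneg_nonneg) (auto intro: deriv_mono)
    ultimately show ?thesis by (simp add: e_def algebra_simps)
  qed
  have "((\<lambda>t. ereal (e (inverse t))) \<longlongrightarrow> (SUP t\<in>{1..}. ereal (e (inverse t)))) at_top"
    by (rule tendsto_SUP_at_top) (auto intro!: anti simp: field_simps)
  then have "((\<lambda>t. ereal (e t)) \<longlongrightarrow> (SUP t\<in>{1..}. ereal (e (inverse t)))) (at_right 0)"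
    by (simp add: filterlim_at_right_to_top)
  moreover have "((\<lambda>t. ereal (deriv f 1 * t)) \<longlongrightarrow> ereal (deriv f 1 * 0)) (at_right 0)"
    by (intro tendsto_intros)
  ultimately have "((\<lambda>t. ereal (e t) + ereal (deriv f 1 * t)) \<longlongrightarrow>
      (SUP t\<in>{1..}. ereal (e (inverse t))) + ereal (deriv f 1 * 0)) (at_right 0)"
    by (intro tendsto_add_ereal_general1) auto
  then have "((\<lambda>t. ereal (f t)) \<longlongrightarrow>
      (SUP t\<in>{1..}. ereal (e (inverse t))) + ereal (deriv f 1 * 0)) (at_right 0)"
    by (simp add: e_def)
  then show ?thesis unfolding f_ext_def by (simp add: tendsto_Lim)
qed

lemma deriv_le_f_slope_inf:
  assumes "0 < r" shows "ereal (deriv f r) \<le> f_slope_inf f"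
proof (rule tendsto_le[OF _ tendsto_f_slope_inf])
  show "((\<lambda>t. ereal (deriv f r + (f r - r * deriv f r) / t)) \<longlongrightarrow> ereal (deriv f r)) at_top"
    by (rule tendsto_ereal)
       (rule tendsto_eq_rhs[OF tendsto_add[OF tendsto_const tendsto_divide_0[OF tendsto_const
          filterlim_at_top_imp_at_infinity[OF filterlim_ident]]]], simp)
  show "\<forall>\<^sub>F t in at_top. ereal (deriv f r + (f r - r * deriv f r) / t) \<le> ereal (f t / t)"
    using eventually_gt_at_top[of 0]
  proof eventually_elim
    case (elim t)
    have "deriv f r + (f r - r * deriv f r) / t = (f r + deriv f r * (t - r)) / t"
      using elim by (simp add: field_simps)
    also have "\<dots> \<le> f t / t"
      using tangent_le[OF assms elim] elim by (intro divide_right_mono) auto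
    finally show ?case by simp
  qed
qed simp

lemma tangent_le_f_ext:
  assumes "0 < r" "0 \<le> t" shows "ereal (f r + deriv f r * (t - r)) \<le> f_ext f t"
proof (cases "t = 0")
  case True
  have "ereal (f r + deriv f r * (0 - r)) \<le> f_ext f 0"
  proof (rule tendsto_le[OF _ tendsto_f_ext_0])
    show "((\<lambda>s. ereal (f r + deriv f r * (s - r))) \<longlongrightarrow> ereal (f r + deriv f r * (0 - r))) (at_right 0)"
      by (intro tendsto_intros)
    show "\<forall>\<^sub>F s in at_right 0. ereal (f r + deriv f r * (s - r)) \<le> ereal (f s)"
      using eventually_at_right_less[of 0] by eventually_elim (use tangent_le assms in auto)
  qed simp
  with True show ?thesis by simp
next
  case False
  then show ?thesis using tangent_le[of r t] assms by (simp add: f_ext_def)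
qed

end

section \<open>Divergences bounded by tangents\<close>

lemma integral_eq_enn2ereal_diff:
  assumes "integrable M v"
  shows "ereal (integral\<^sup>L M v) =
    enn2ereal (\<integral>\<^sup>+ x. ennreal (v x) \<partial>M) - enn2ereal (\<integral>\<^sup>+ x. ennreal (- v x) \<partial>M)"
proof -
  have enn: "enn2ereal a = ereal (enn2real a)" if "a \<noteq> \<infinity>" for a
    using that by (cases a) (simp_all add: enn2ereal_ennreal)
  have 1: "(\<integral>\<^sup>+ x. ennreal (v x) \<partial>M) \<noteq> \<infinity>" and 2: "(\<integral>\<^sup>+ x. ennreal (- v x) \<partial>M) \<noteq> \<infinity>"
    using assms by (simp_all add: real_integrable_def)
  show ?thesis
    by (simp only: enn[OF 1] enn[OF 2] real_lebesgue_integral_def[OF assms] ereal_minus(1))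
qed

lemma ereal_integral_ge:
  assumes v: "integrable M v" and le: "AE x in M. ereal (v x) \<le> u x"
  shows "ereal (integral\<^sup>L M v) \<le> ereal_integral M u"
proof -
  have 1: "(\<integral>\<^sup>+ x. ennreal (v x) \<partial>M) \<le> (\<integral>\<^sup>+ x. e2ennreal (u x) \<partial>M)"
  proof (rule nn_integral_mono_AE)
    show "AE x in M. ennreal (v x) \<le> e2ennreal (u x)"
      using le by eventually_elim (metis e2ennreal_mono e2ennreal_ereal)
  qed
  have 2: "(\<integral>\<^sup>+ x. e2ennreal (- u x) \<partial>M) \<le> (\<integral>\<^sup>+ x. ennreal (- v x) \<partial>M)"
  proof (rule nn_integral_mono_AE)
    show "AE x in M. e2ennreal (- u x) \<le> ennreal (- v x)"
      using le
    proof eventually_elim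
      case (elim x)
      then have "- u x \<le> ereal (- v x)" by (metis ereal_minus_le_minus uminus_ereal.simps(1))
      then show ?case by (metis e2ennreal_mono e2ennreal_ereal)
    qed
  qed
  show ?thesis
    unfolding ereal_integral_def integral_eq_enn2ereal_diff[OF v]
    using 1 2 by (intro ereal_minus_mono) (simp_all add: less_eq_ennreal.rep_eq)
qed

lemma ereal_integral_eq_integral:
  assumes v: "integrable M v" and eq: "AE x in M. u x = ereal (v x)"
  shows "ereal_integral M u = ereal (integral\<^sup>L M v)"
proof -
  have "(\<integral>\<^sup>+ x. e2ennreal (u x) \<partial>M) = (\<integral>\<^sup>+ x. ennreal (v x) \<partial>M)"
    using eq by (intro nn_integral_cong_AE) (auto simp: e2ennreal_ereal)
  moreover have "(\<integral>\<^sup>+ x. e2ennreal (- u x) \<partial>M) = (\<integral>\<^sup>+ x. ennreal (- v x) \<partial>M)"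
    using eq by (intro nn_integral_cong_AE) (auto simp: e2ennreal_ereal)
  ultimately show ?thesis
    by (simp only: ereal_integral_def integral_eq_enn2ereal_diff[OF v])
qed

lemma dominating_measure_exists:
  assumes P: "prob_space P" and Q: "prob_space Q" and sets: "sets P = sets Q"
  shows "\<exists>R. sigma_finite_measure R \<and> sets R = sets P \<and> absolutely_continuous R P \<and> absolutely_continuous R Q"
proof -
  \<comment> \<open>The dominating measure is the average of \<open>P\<close> and \<open>Q\<close>, obtained by tossing a fair coin.\<close>
  define K where "K = (\<lambda>b. if b then P else Q)"
  define R where "R = measure_pmf (bernoulli_pmf (1/2)) \<bind> K"
  have "K b \<in> space (subprob_algebra P)" for b
    using prob_space_imp_subprob_space[OF P] prob_space_imp_subprob_space[OF Q] sets[symmetric]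
    by (simp add: K_def space_subprob_algebra)
  then have K: "K \<in> measure_pmf (bernoulli_pmf (1/2)) \<rightarrow>\<^sub>M subprob_algebra P" by simp
  have sR: "sets R = sets P"
    unfolding R_def by (rule sets_bind) (simp_all add: K_def sets[symmetric])
  have em: "emeasure R A = ennreal (1/2) * emeasure P A + ennreal (1/2) * emeasure Q A" if "A \<in> sets P" for A
    unfolding R_def using that
    by (subst emeasure_bind[OF _ K]) (auto simp: K_def nn_integral_bernoulli_pmf mult.commute)
  have spQ: "space Q = space P" using sets_eq_imp_space_eq[OF sets] by simp
  have "emeasure R (space P) = ennreal (1/2) * 1 + ennreal (1/2) * 1"
    using prob_space.emeasure_space_1[OF P] prob_space.emeasure_space_1[OF Q]
    by (subst em) (auto simp: spQ)
  also have "\<dots> < \<infinity>"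
    by (simp only: infinity_ennreal_def ennreal_mult_less_top ennreal_add_less_top ennreal_less_top) simp
  finally have "finite_measure R"
    using sets_eq_imp_space_eq[OF sR] by (intro finite_measureI) auto
  then have "sigma_finite_measure R" by (rule finite_measure.axioms(1))
  moreover have "absolutely_continuous R P" "absolutely_continuous R Q"
    unfolding absolutely_continuous_def null_sets_def using em sets sR by auto
  ultimately show ?thesis using sR by blast
qed

lemma f_divergence_reference:
  assumes "prob_space P" "prob_space Q" "sets P = sets Q"
  obtains R where "sigma_finite_measure R" "sets R = sets P" "absolutely_continuous R P"
    "absolutely_continuous R Q" "f_divergence f P Q = f_divergence_wrt R f P Q"
  using someI_ex[OF dominating_measure_exists[OF assms]] that unfolding f_divergence_def by blast

lemma real_density_RN_deriv:
  assumes R: "sigma_finite_measure R" and P: "prob_space P" and "sets P = sets R" "absolutely_continuous R P"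
  shows "density R (\<lambda>x. ennreal (enn2real (RN_deriv R P x))) = P"
proof -
  interpret R: sigma_finite_measure R by fact
  interpret P: prob_space P by fact
  have "AE x in R. RN_deriv R P x \<noteq> \<infinity>"
    using assms by (intro R.RN_deriv_finite) (auto intro: P.sigma_finite_measure_axioms)
  then have "AE x in R. ennreal (enn2real (RN_deriv R P x)) = RN_deriv R P x"
    by eventually_elim (simp add: less_top)
  then have "density R (\<lambda>x. ennreal (enn2real (RN_deriv R P x))) = density R (RN_deriv R P)"
    by (intro density_cong) auto
  then show ?thesis using R.density_RN_deriv assms by simp
qed

context divergence_generator begin

text \<open>
  The variational lower bound: any positive function \<open>r\<close>, thought of as a guess for the density of \<open>P\<close>
  with respect to \<open>Q\<close>, bounds the divergence from below by the integrated tangent of \<open>f\<close> at \<open>r\<close>.  The part of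
  \<open>P\<close> that is singular to \<open>Q\<close> is controlled because every slope of \<open>f\<close> is at most \<open>f_slope_inf f\<close>.
\<close>

lemma f_divergence_ge:
  assumes P: "prob_space P" and Q: "prob_space Q" and sets: "sets P = sets Q"
    and r: "r \<in> borel_measurable Q" "\<And>x. 0 < r x"
    and intP: "integrable P (\<lambda>x. deriv f (r x))"
    and intQ: "integrable Q (\<lambda>x. f (r x) - r x * deriv f (r x))"
  shows "ereal ((\<integral>x. deriv f (r x) \<partial>P) + (\<integral>x. f (r x) - r x * deriv f (r x) \<partial>Q)) \<le> f_divergence f P Q"
proof -
  obtain R where R: "sigma_finite_measure R" and sR: "sets R = sets P"
    and ac: "absolutely_continuous R P" "absolutely_continuous R Q"
    and div: "f_divergence f P Q = f_divergence_wrt R f P Q"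
    using f_divergence_reference[OF P Q sets] by metis
  interpret P: prob_space P by fact
  define p where "p x = enn2real (RN_deriv R P x)" for x
  define q where "q x = enn2real (RN_deriv R Q x)" for x
  define b where "b x = deriv f (r x)" for x
  define c where "c x = f (r x) - r x * deriv f (r x)" for x
  have [measurable]: "p \<in> borel_measurable R" "q \<in> borel_measurable R"
    unfolding p_def[abs_def] q_def[abs_def]
    by simp_all
  have p0: "0 \<le> p x" and q0: "0 \<le> q x" for x by (auto simp: p_def q_def)
  have Pd: "density R (\<lambda>x. ennreal (p x)) = P"
    unfolding p_def using R P sR ac by (intro real_density_RN_deriv) auto
  have Qd: "density R (\<lambda>x. ennreal (q x)) = Q"
    unfolding q_def using R Q sR sets ac by (intro real_density_RN_deriv) auto
  have intb: "integrable P b" and intc: "integrable Q c"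
    using intP intQ unfolding b_def[abs_def] c_def[abs_def] .
  have bmP: "b \<in> borel_measurable P" and cmQ: "c \<in> borel_measurable Q"
    using intb intc by simp_all
  have bmR[measurable]: "b \<in> borel_measurable R"
    unfolding measurable_cong_sets[OF sR refl] by (fact bmP)
  have cmR[measurable]: "c \<in> borel_measurable R"
    unfolding measurable_cong_sets[OF sR refl] measurable_cong_sets[OF sets refl] by (fact cmQ)
  have ib: "integrable R (\<lambda>x. p x * b x)"
    using intb integrable_real_density[of p R b] p0 by (simp add: Pd)
  have ic: "integrable R (\<lambda>x. q x * c x)"
    using intc integrable_real_density[of q R c] q0 by (simp add: Qd)
  have eb: "(\<integral>x. b x \<partial>P) = (\<integral>x. p x * b x \<partial>R)"
    using integral_real_density[of p R b] p0 by (simp add: Pd)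
  have ec: "(\<integral>x. c x \<partial>Q) = (\<integral>x. q x * c x \<partial>R)"
    using integral_real_density[of q R c] q0 by (simp add: Qd)
  define Z where "Z = {x \<in> space P. q x = 0}"
  have spR: "space R = space P" using sets_eq_imp_space_eq[OF sR] .
  have Z[measurable]: "Z \<in> sets R" unfolding Z_def spR[symmetric] by measurable
  \<comment> \<open>The tangent bound \<open>b p + c q\<close>, cut off outside the support of \<open>q\<close>.\<close>
  define v where "v x = p x * b x + q x * c x - p x * (b x * indicator Z x)" for x
  have ibZ: "integrable R (\<lambda>x. p x * (b x * indicator Z x))"
    using integrable_mult_indicator[OF Z ib] by (simp add: mult_ac)
  have iv: "integrable R v"
    unfolding v_def
    by (intro Bochner_Integration.integrable_add Bochner_Integration.integrable_diff ib ic ibZ)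
  have "AE x in R. ereal (v x) \<le> (if q x > 0 then f_ext f (p x / q x) * ereal (q x) else 0)"
  proof (rule AE_I2)
    fix x assume x: "x \<in> space R"
    show "ereal (v x) \<le> (if q x > 0 then f_ext f (p x / q x) * ereal (q x) else 0)"
    proof (cases "q x > 0")
      case True
      then have "v x = p x * b x + q x * c x" by (simp add: v_def Z_def)
      also have "\<dots> = (f (r x) + deriv f (r x) * (p x / q x - r x)) * q x"
        using True by (simp add: b_def c_def field_simps)
      finally have "ereal (v x) = ereal (f (r x) + deriv f (r x) * (p x / q x - r x)) * ereal (q x)"
        by simp
      also have "\<dots> \<le> f_ext f (p x / q x) * ereal (q x)"
        using r(2)[of x] p0[of x] q0[of x] by (intro ereal_mult_right_mono tangent_le_f_ext) simp_all
      finally show ?thesis using True by simp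
    next
      case False
      then have "q x = 0" using q0[of x] by simp
      then show ?thesis using x spR by (simp add: v_def Z_def)
    qed
  qed
  from ereal_integral_ge[OF iv this]
  have 1: "ereal (integral\<^sup>L R v) \<le> ereal_integral R (\<lambda>x. if q x > 0 then f_ext f (p x / q x) * ereal (q x) else 0)" .
  have ZP: "Z \<in> sets P" using Z sR by simp
  have bZ: "(\<integral>x. p x * (b x * indicator Z x) \<partial>R) = (\<integral>x. b x * indicator Z x \<partial>P)"
    using integral_real_density[of p R "\<lambda>x. b x * indicator Z x"] p0 by (simp add: Pd)
  have 2: "ereal (\<integral>x. b x * indicator Z x \<partial>P) \<le> enn2ereal (emeasure P Z) * f_slope_inf f"
  proof (cases "f_slope_inf f")
    case (real L)
    have "(\<integral>x. b x * indicator Z x \<partial>P) \<le> (\<integral>x. L * indicator Z x \<partial>P)"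
    proof (rule integral_mono)
      show "integrable P (\<lambda>x. b x * indicator Z x)"
        using integrable_mult_indicator[OF ZP intb] by (simp add: mult_ac)
      show "b x * indicator Z x \<le> L * indicator Z x" for x
        using deriv_le_f_slope_inf[OF r(2)[of x]] real by (auto simp: b_def split: split_indicator)
      show "integrable P (\<lambda>x. L * indicator Z x)"
        using ZP by (intro integrable_mult_right integrable_real_indicator)
          (simp_all add: P.emeasure_eq_measure)
    qed
    also have "\<dots> = L * measure P Z" using ZP by simp
    finally show ?thesis by (simp add: real P.emeasure_eq_measure enn2ereal_ennreal mult.commute)
  next
    case PInf
    show ?thesis
    proof (cases "measure P Z = 0")
      case True
      have "AE x in P. x \<notin> Z" using True ZP P.emeasure_eq_measure by (intro AE_not_in) (auto simp: null_sets_def)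
      then have "(\<integral>x. b x * indicator Z x \<partial>P) = (\<integral>x. 0 \<partial>P)"
        by (intro integral_cong_AE) (use bmP ZP in auto)
      then show ?thesis using True by (simp add: P.emeasure_eq_measure zero_ennreal.rep_eq)
    next
      case False
      then have "measure P Z > 0" by (simp add: zero_less_measure_iff)
      then show ?thesis by (simp add: P.emeasure_eq_measure enn2ereal_ennreal PInf)
    qed
  next
    case MInf
    then show ?thesis using deriv_le_f_slope_inf[of 1] by simp
  qed
  have "integral\<^sup>L R v = (\<integral>x. b x \<partial>P) + (\<integral>x. c x \<partial>Q) - (\<integral>x. b x * indicator Z x \<partial>P)"
    unfolding v_def by (simp add: ib ic ibZ eb ec bZ)
  then have "ereal ((\<integral>x. b x \<partial>P) + (\<integral>x. c x \<partial>Q)) = ereal (integral\<^sup>L R v) + ereal (\<integral>x. b x * indicator Z x \<partial>P)"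
    by simp
  also have "\<dots> \<le> f_divergence f P Q"
    unfolding div f_divergence_wrt_def Let_def p_def[symmetric] q_def[symmetric] Z_def[symmetric]
    using 1 2 by (rule add_mono)
  finally show ?thesis by (simp add: b_def c_def)
qed

lemma f_divergence_density:
  assumes P: "prob_space P" and Q: "prob_space Q"
    and r: "r \<in> borel_measurable Q" "\<And>x. 0 < r x"
    and dens: "P = density Q (\<lambda>x. ennreal (r x))"
    and int: "integrable Q (\<lambda>x. f (r x))"
  shows "f_divergence f P Q = ereal (\<integral>x. f (r x) \<partial>Q)"
proof -
  have sets: "sets P = sets Q" using dens by simp
  obtain R where R: "sigma_finite_measure R" and sR: "sets R = sets P"
    and ac: "absolutely_continuous R P" "absolutely_continuous R Q"
    and div: "f_divergence f P Q = f_divergence_wrt R f P Q"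
    using f_divergence_reference[OF P Q sets] by metis
  interpret R: sigma_finite_measure R by fact
  define p where "p x = enn2real (RN_deriv R P x)" for x
  define q where "q x = enn2real (RN_deriv R Q x)" for x
  have [measurable]: "p \<in> borel_measurable R" "q \<in> borel_measurable R"
    unfolding p_def[abs_def] q_def[abs_def]
    by simp_all
  have p0: "0 \<le> p x" and q0: "0 \<le> q x" for x by (auto simp: p_def q_def)
  have Qd: "density R (\<lambda>x. ennreal (q x)) = Q"
    unfolding q_def using R Q sR sets ac by (intro real_density_RN_deriv) auto
  have mR: "r \<in> borel_measurable R" "(\<lambda>x. f (r x)) \<in> borel_measurable R"
    unfolding measurable_cong_sets[OF sR refl] measurable_cong_sets[OF sets refl]
    using r(1) int by simp_all
  note [measurable] = mR
  have "P = density R (\<lambda>x. ennreal (q x) * ennreal (r x))"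
    unfolding dens Qd[symmetric] by (subst density_density_eq) auto
  then have "AE x in R. ennreal (q x) * ennreal (r x) = RN_deriv R P x"
    by (intro R.RN_deriv_unique) auto
  then have pq: "AE x in R. p x = q x * r x"
  proof eventually_elim
    case (elim x)
    then show ?case unfolding p_def using q0[of x] r(2)[of x]
      by (simp add: less_imp_le flip: elim ennreal_mult)
  qed
  have i: "integrable R (\<lambda>x. q x * f (r x))"
    using int Qd integrable_real_density[of q R "\<lambda>x. f (r x)"] q0 by simp
  have "AE x in R. (if q x > 0 then f_ext f (p x / q x) * ereal (q x) else 0) = ereal (q x * f (r x))"
    using pq
  proof eventually_elim
    case (elim x)
    then show ?case using q0[of x] r(2)[of x] by (auto simp: f_ext_def mult.commute)
  qed
  from ereal_integral_eq_integral[OF i this]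
  have 1: "ereal_integral R (\<lambda>x. if q x > 0 then f_ext f (p x / q x) * ereal (q x) else 0)
      = ereal (\<integral>x. f (r x) \<partial>Q)"
    using integral_real_density[of q R "\<lambda>x. f (r x)"] q0 by (simp add: Qd)
  have spR: "space R = space P" using sets_eq_imp_space_eq[OF sR] .
  have Zm: "{x \<in> space R. q x = 0} \<in> sets R" by measurable
  have "emeasure (density R (\<lambda>x. ennreal (q x))) {x \<in> space R. q x = 0} = (\<integral>\<^sup>+x. 0 \<partial>R)"
    unfolding emeasure_density[OF _ Zm, of "\<lambda>x. ennreal (q x)", simplified]
    by (intro nn_integral_cong) (auto split: split_indicator)
  then have "{x \<in> space P. q x = 0} \<in> null_sets Q"
    using Zm sR sets by (auto simp: null_sets_def Qd spR)
  then have "{x \<in> space P. q x = 0} \<in> null_sets P"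
    using absolutely_continuousI_density[of "\<lambda>x. ennreal (r x)" Q] r unfolding dens absolutely_continuous_def by auto
  then have 2: "emeasure P {x \<in> space P. q x = 0} = 0" by auto
  show ?thesis unfolding div f_divergence_wrt_def Let_def p_def[symmetric] q_def[symmetric]
    using 1 2 by (simp add: zero_ennreal.rep_eq)
qed

end

section \<open>Cylinder sets of the boundary\<close>

text \<open>
  Second countability of the integers makes the Borel sets of sequences of integers those of the product
  sigma-algebra.
\<close>

instance int :: second_countable_topology
proof
  show "\<exists>B::int set set. countable B \<and> open = generate_topology B"
  proof (intro exI[of _ "range (\<lambda>a. {a})"] conjI ext)
    fix U :: "int set"
    have "generate_topology (range (\<lambda>a. {a})) (\<Union>((\<lambda>a. {a}) ` U))"
      by (intro generate_topology.UN) (auto intro: generate_topology.Basis)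
    then show "open U = generate_topology (range (\<lambda>a. {a})) U"
      by (simp add: Topological_Spaces.open_discrete)
  qed auto
qed

text \<open>
  The cylinder of boundary points with prefix \<open>w\<close>.  All integer lists are allowed; the cylinder
  is empty if \<open>w\<close> is not reduced or uses an integer that is not a letter.
\<close>

definition cyl :: "nat \<Rightarrow> int list \<Rightarrow> (nat \<Rightarrow> int) set" where
  "cyl d w = {\<xi> \<in> boundary d. \<forall>k<length w. \<xi> k = w ! k}"

lemma cyl_Nil [simp]: "cyl d [] = boundary d"
  by (simp add: cyl_def)

lemma mem_cyl_Cons: "\<xi> \<in> cyl d (a # w) \<longleftrightarrow> \<xi> \<in> boundary d \<and> \<xi> 0 = a \<and> (\<forall>k<length w. \<xi> (Suc k) = w ! k)"
  by (auto simp: cyl_def less_Suc_eq_0_disj)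

lemma cyl_empty_letter: "a \<notin> letters d \<Longrightarrow> cyl d (a # w) = {}"
  by (auto simp: mem_cyl_Cons boundary_def)

lemma cyl_empty_inverse: "b = - a \<Longrightarrow> cyl d (a # b # w) = {}"
  by (auto simp: mem_cyl_Cons boundary_def) (metis length_Cons nth_Cons_0 zero_less_Suc)

lemma cyl_subset_boundary: "cyl d w \<subseteq> boundary d"
  by (auto simp: cyl_def)

lemma cyl_Int:
  assumes "length v \<le> length w"
  shows "cyl d v \<inter> cyl d w = (if \<forall>k<length v. w ! k = v ! k then cyl d w else {})"
proof (cases "\<forall>k<length v. w ! k = v ! k")
  case True
  then have "cyl d w \<subseteq> cyl d v" using assms by (fastforce simp: cyl_def)
  with True show ?thesis by auto
next
  case False
  then obtain k where k: "k < length v" "w ! k \<noteq> v ! k" by blast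
  then have "cyl d v \<inter> cyl d w = {}" using assms unfolding cyl_def by force
  with False show ?thesis by auto
qed

lemma boundary_eq_UN_cyl: "boundary d = (\<Union>a. cyl d [a])"
  by (auto simp: cyl_def)

lemma space_boundary_borel: "space (boundary_borel d) = boundary d"
  by (simp add: boundary_borel_def space_restrict_space)

lemma measurable_coord [measurable]: "(\<lambda>\<xi>. \<xi> n) \<in> boundary_borel d \<rightarrow>\<^sub>M (count_space UNIV :: int measure)"
proof -
  have "(\<lambda>\<xi>::nat \<Rightarrow> int. \<xi> n) \<in> borel \<rightarrow>\<^sub>M (borel :: int measure)"
    by measurable
  then have "(\<lambda>\<xi>. \<xi> n) \<in> boundary_borel d \<rightarrow>\<^sub>M (borel :: int measure)"
    unfolding boundary_borel_def by (rule measurable_restrict_space1)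
  then show ?thesis by (simp add: measurable_cong_sets[OF refl sets_borel_eq_count_space])
qed

lemma sets_cyl [measurable, simp]: "cyl d w \<in> sets (boundary_borel d)"
proof -
  have "cyl d w = {\<xi> \<in> space (boundary_borel d). \<forall>k<length w. \<xi> k = w ! k}"
    by (simp add: cyl_def space_boundary_borel)
  also have "\<dots> \<in> sets (boundary_borel d)" by measurable
  finally show ?thesis .
qed

text \<open>
  Nonempty words suffice to generate the Borel sets, so measures can be compared
  without treating the total mass separately.
\<close>

lemma Int_stable_cyl: "Int_stable (cyl d ` {w. w \<noteq> []})"
proof (rule Int_stableI)
  fix A B assume "A \<in> cyl d ` {w. w \<noteq> []}" "B \<in> cyl d ` {w. w \<noteq> []}"
  then obtain v w where vw: "v \<noteq> []" "w \<noteq> []" "A = cyl d v" "B = cyl d w" by auto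
  have "{} = cyl d [0]" by (subst cyl_empty_letter) (simp_all add: letters_def)
  then have e: "{} \<in> cyl d ` {w. w \<noteq> []}" by (rule image_eqI) simp
  have "A \<inter> B = A \<or> A \<inter> B = B \<or> A \<inter> B = {}"
  proof (cases "length v \<le> length w")
    case True
    show ?thesis unfolding vw cyl_Int[OF True] by simp
  next
    case False
    then have "length w \<le> length v" by simp
    from cyl_Int[OF this, of d] show ?thesis unfolding vw Int_commute[of "cyl d v"] by simp
  qed
  moreover have "A \<in> cyl d ` {w. w \<noteq> []}" "B \<in> cyl d ` {w. w \<noteq> []}" using vw by blast+
  ultimately show "A \<inter> B \<in> cyl d ` {w. w \<noteq> []}" using e by metis
qed

lemma sets_boundary_borel_eq: "sets (boundary_borel d) = sigma_sets (boundary d) (cyl d ` {w. w \<noteq> []})"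
proof
  let ?E = "cyl d ` {w. w \<noteq> []}"
  have sub: "?E \<subseteq> Pow (boundary d)" using cyl_subset_boundary by auto
  define S where "S = sigma (boundary d) ?E"
  have spS: "space S = boundary d" and stS: "sets S = sigma_sets (boundary d) ?E"
    using sub by (auto simp: S_def)
  show "sigma_sets (boundary d) ?E \<subseteq> sets (boundary_borel d)"
    using sets.sigma_sets_subset[of ?E "boundary_borel d"]
    by (simp add: space_boundary_borel image_subset_iff)
  have "(\<lambda>\<xi>. \<xi>) \<in> S \<rightarrow>\<^sub>M (borel :: (nat \<Rightarrow> int) measure)"
  proof (rule measurable_coordinatewise_then_product)
    fix n
    have "(\<lambda>\<xi>. \<xi> n) \<in> S \<rightarrow>\<^sub>M (count_space UNIV :: int measure)"
    proof (subst measurable_count_space_eq2_countable, safe)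
      fix a :: int
      have "(\<lambda>\<xi>. \<xi> n) -` {a} \<inter> space S = (\<Union>w\<in>{w. length w = Suc n \<and> w ! n = a}. cyl d w)"
      proof (intro equalityI subsetI)
        fix \<xi> assume "\<xi> \<in> (\<lambda>\<xi>. \<xi> n) -` {a} \<inter> space S"
        then have "\<xi> \<in> cyl d (map \<xi> [0..<Suc n])" "map \<xi> [0..<Suc n] ! n = a"
          by (auto simp: cyl_def spS simp del: upt_Suc)
        then show "\<xi> \<in> (\<Union>w\<in>{w. length w = Suc n \<and> w ! n = a}. cyl d w)"
          by (intro UN_I[of "map \<xi> [0..<Suc n]"]) (simp_all del: upt_Suc)
      qed (auto simp: cyl_def spS)
      also have "\<dots> \<in> sets S"
      proof (rule sets.countable_UN'')
        show "countable {w. length w = Suc n \<and> w ! n = a}" by (rule countableI_type)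
        fix w :: "int list" assume "w \<in> {w. length w = Suc n \<and> w ! n = a}"
        then have "w \<in> {w. w \<noteq> []}" by auto
        then have "cyl d w \<in> ?E" by (rule imageI)
        then show "cyl d w \<in> sets S" unfolding stS by (rule sigma_sets.Basic)
      qed
      finally show "(\<lambda>\<xi>. \<xi> n) -` {a} \<inter> space S \<in> sets S" .
    qed simp_all
    then show "(\<lambda>\<xi>. \<xi> n) \<in> S \<rightarrow>\<^sub>M (borel :: int measure)"
      by (simp add: measurable_cong_sets[OF refl sets_borel_eq_count_space])
  qed
  then have "(\<lambda>\<xi>. \<xi>) -` A \<inter> space S \<in> sets S" if "A \<in> sets borel" for A
    using that by (rule measurable_sets)
  then have *: "boundary d \<inter> A \<in> sigma_sets (boundary d) ?E" if "A \<in> sets borel" for A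
    using that by (simp add: spS stS Int_commute)
  show "sets (boundary_borel d) \<subseteq> sigma_sets (boundary d) ?E"
    unfolding boundary_borel_def sets_restrict_space image_subset_iff using * by blast
qed

lemma measure_eqI_cyl:
  assumes "sets M = sets (boundary_borel d)" "sets N = sets (boundary_borel d)" "finite_measure M"
    and eq: "\<And>a w. a \<in> letters d \<Longrightarrow> emeasure M (cyl d (a # w)) = emeasure N (cyl d (a # w))"
  shows "M = N"
proof (rule measure_eqI_generator_eq_countable[where E = "cyl d ` {w. w \<noteq> []}" and \<Omega> = "boundary d"
      and A = "range (\<lambda>a. cyl d [a])"])
  fix X assume "X \<in> cyl d ` {w. w \<noteq> []}"
  then obtain a w where "X = cyl d (a # w)" by (auto simp: neq_Nil_conv)
  then show "emeasure M X = emeasure N X"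
    using eq[of a w] cyl_empty_letter[of a d w] by (cases "a \<in> letters d") auto
next
  show "emeasure M X \<noteq> \<infinity>" for X using finite_measure.emeasure_finite[OF assms(3)] by simp
  show "cyl d ` {w. w \<noteq> []} \<subseteq> Pow (boundary d)" using cyl_subset_boundary by auto
qed (use assms in \<open>auto simp: Int_stable_cyl sets_boundary_borel_eq boundary_eq_UN_cyl[symmetric]\<close>)

lemma finite_letters [simp]: "finite (letters d)"
proof -
  have "letters d \<subseteq> {- int d..int d}" by (auto simp: letters_def)
  then show ?thesis by (rule finite_subset) simp
qed

lemma uminus_letters [simp]: "- i \<in> letters d \<longleftrightarrow> i \<in> letters d"
  by (simp add: letters_def)

lemma letters_nonzero: "i \<in> letters d \<Longrightarrow> i \<noteq> 0"
  by (simp add: letters_def)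

lemma act_letter_boundary:
  assumes "a \<in> letters d" "\<xi> \<in> boundary d" shows "act_letter a \<xi> \<in> boundary d"
  using assms by (auto simp: boundary_def act_letter_def split: nat.splits)

lemma act_singleton: "act [a] = act_letter a"
  by (simp add: act_def fun_eq_iff)

lemma measurable_act_letter [measurable]:
  assumes "a \<in> letters d"
  shows "act_letter a \<in> boundary_borel d \<rightarrow>\<^sub>M boundary_borel d"
proof -
  have "act_letter a \<in> boundary_borel d \<rightarrow>\<^sub>M borel"
  proof (rule measurable_coordinatewise_then_product)
    fix n
    have "(\<lambda>\<xi>. act_letter a \<xi> n) = (\<lambda>\<xi>. if \<xi> 0 = - a then \<xi> (Suc n) else case n of 0 \<Rightarrow> a | Suc m \<Rightarrow> \<xi> m)"
      by (auto simp: act_letter_def fun_eq_iff)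
    also have "\<dots> \<in> boundary_borel d \<rightarrow>\<^sub>M count_space UNIV"
      by (cases n) simp_all
    finally show "(\<lambda>\<xi>. act_letter a \<xi> n) \<in> boundary_borel d \<rightarrow>\<^sub>M borel"
      by (simp add: measurable_cong_sets[OF refl sets_borel_eq_count_space])
  qed
  then show ?thesis
    unfolding boundary_borel_def[of d]
    by (intro measurable_restrict_space2)
       (use assms act_letter_boundary in \<open>auto simp: space_restrict_space boundary_borel_def\<close>)
qed

text \<open>
  In the case \<open>i = a\<close> the set is empty if \<open>w\<close> begins with \<open>- a\<close>, the complement of a
  cylinder if \<open>w\<close> is empty, and \<open>cyl d w\<close> otherwise.
\<close>

lemma vimage_act_letter_cyl:
  assumes "i \<in> letters d" "a \<in> letters d"
  shows "act_letter i -` cyl d (a # w) \<inter> boundary d =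
    (if i = a then cyl d w - cyl d [- a] else cyl d (- i # a # w))"
proof -
  have "act_letter i \<xi> \<in> cyl d (a # w) \<longleftrightarrow>
      \<xi> \<in> (if i = a then cyl d w - cyl d [- a] else cyl d (- i # a # w))" if \<xi>: "\<xi> \<in> boundary d" for \<xi>
  proof (cases "\<xi> 0 = - i")
    case True
    then have ne: "\<xi> (Suc 0) \<noteq> i" using \<xi> unfolding boundary_def by (metis (mono_tags) add.inverse_inverse mem_Collect_eq)
    have "act_letter i \<xi> \<in> cyl d (a # w) \<longleftrightarrow> \<xi> (Suc 0) = a \<and> (\<forall>k<length w. \<xi> (Suc (Suc k)) = w ! k)"
      using act_letter_boundary[OF assms(1) \<xi>] True by (simp add: mem_cyl_Cons act_letter_def)
    with True ne \<xi> show ?thesis by (auto simp: mem_cyl_Cons less_Suc_eq_0_disj)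
  next
    case False
    have "act_letter i \<xi> \<in> cyl d (a # w) \<longleftrightarrow> i = a \<and> (\<forall>k<length w. \<xi> k = w ! k)"
      using act_letter_boundary[OF assms(1) \<xi>] False by (simp add: mem_cyl_Cons act_letter_def)
    with False \<xi> show ?thesis by (auto simp: mem_cyl_Cons) (auto simp: cyl_def)
  qed
  then show ?thesis by (auto simp: cyl_subset_boundary[THEN subsetD])
qed

lemma boundary_probsD:
  assumes "\<nu> \<in> boundary_probs d"
  shows "prob_space \<nu>" "sets \<nu> = sets (boundary_borel d)" "space \<nu> = boundary d"
  using assms sets_eq_imp_space_eq[of \<nu> "boundary_borel d"]
  by (auto simp: boundary_probs_def space_boundary_borel)

lemma translate_boundary_probs:
  assumes \<nu>: "\<nu> \<in> boundary_probs d" and i: "i \<in> letters d"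
  shows "translate d [i] \<nu> \<in> boundary_probs d"
proof -
  have "act_letter i \<in> \<nu> \<rightarrow>\<^sub>M boundary_borel d"
    unfolding measurable_cong_sets[OF boundary_probsD(2)[OF \<nu>] refl]
    using i by (rule measurable_act_letter)
  then show ?thesis
    unfolding translate_def act_singleton boundary_probs_def
    using prob_space.prob_space_distr[OF boundary_probsD(1)[OF \<nu>]] by simp
qed

lemma emeasure_translate_cyl:
  assumes \<nu>: "\<nu> \<in> boundary_probs d" and i: "i \<in> letters d" and a: "a \<in> letters d"
  shows "emeasure (translate d [i] \<nu>) (cyl d (a # w)) =
    emeasure \<nu> (if i = a then cyl d w - cyl d [- a] else cyl d (- i # a # w))"
proof -
  have m: "act_letter i \<in> \<nu> \<rightarrow>\<^sub>M boundary_borel d"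
    unfolding measurable_cong_sets[OF boundary_probsD(2)[OF \<nu>] refl]
    using i by (rule measurable_act_letter)
  show ?thesis
    unfolding translate_def act_singleton
    using m vimage_act_letter_cyl[OF i a, of w] boundary_probsD(3)[OF \<nu>]
    by (simp only: emeasure_distr sets_cyl)
qed

lemma measure_translate_cyl:
  assumes "\<nu> \<in> boundary_probs d" "i \<in> letters d" "a \<in> letters d"
  shows "measure (translate d [i] \<nu>) (cyl d (a # w)) =
    measure \<nu> (if i = a then cyl d w - cyl d [- a] else cyl d (- i # a # w))"
  unfolding measure_def emeasure_translate_cyl[OF assms] ..

lemma sum_measure_cyl_letters:
  assumes \<nu>: "\<nu> \<in> boundary_probs d"
  shows "(\<Sum>a\<in>letters d. measure \<nu> (cyl d [a])) = 1"
proof -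
  interpret prob_space \<nu> using boundary_probsD[OF \<nu>] by simp
  have "measure \<nu> (\<Union>a\<in>letters d. cyl d [a]) = (\<Sum>a\<in>letters d. measure \<nu> (cyl d [a]))"
  proof (rule finite_measure_finite_Union)
    show "disjoint_family_on (\<lambda>a. cyl d [a]) (letters d)"
      by (auto simp: disjoint_family_on_def cyl_def)
  qed (simp_all add: boundary_probsD[OF \<nu>] image_subset_iff)
  moreover have "(\<Union>a\<in>letters d. cyl d [a]) = space \<nu>"
    by (auto simp: boundary_probsD[OF \<nu>] cyl_def boundary_def)
  ultimately show ?thesis using prob_space by simp
qed

lemma measure_boundary_diff_cyl:
  assumes \<nu>: "\<nu> \<in> boundary_probs d"
  shows "measure \<nu> (cyl d [] - cyl d [a]) = 1 - measure \<nu> (cyl d [a])"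
  using prob_space.prob_compl[OF boundary_probsD(1)[OF \<nu>], of "cyl d [a]"] boundary_probsD[OF \<nu>]
  by simp

section \<open>Stationary measures\<close>

lemma inv_letter:
  assumes "i \<in> letters d" shows "inv\<^bsub>free_grp d\<^esub> [i] = [- i]"
  using assms letters_nonzero[OF assms]
  by (intro group.inv_equality[OF group_free_grp])
     (auto simp: free_grp_def mult_letter_def reduced_Cons reduced_Nil)

lemma letter_carrier: "i \<in> letters d \<Longrightarrow> [i] \<in> carrier (free_grp d)"
  by (simp add: free_grp_def reduced_Cons reduced_Nil)

lemma set_mult_letter: "set (mult_letter a w) \<subseteq> insert a (set w)"
  by (auto simp: mult_letter_def dest: list.set_sel(2))

lemma set_foldr_mult_letter: "set (foldr mult_letter v w) \<subseteq> set v \<union> set w"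
  using set_mult_letter by (induction v) fastforce+

context
  fixes d :: nat and \<mu> :: "int list pmf"
  assumes \<mu>: "\<mu> \<in> Delta d"
begin

lemma set_pmf_Delta: "set_pmf \<mu> \<subseteq> (\<lambda>i. [i]) ` letters d"
  using \<mu> by (simp add: Delta_def)

lemma pmf_Delta_uminus:
  assumes "i \<in> letters d" shows "pmf \<mu> [- i] = pmf \<mu> [i]"
  using \<mu> letter_carrier[OF assms] inv_letter[OF assms] unfolding Delta_def by auto

lemma sum_pmf_Delta: "(\<Sum>i\<in>letters d. pmf \<mu> [i]) = 1"
proof -
  have "(\<Sum>i\<in>letters d. pmf \<mu> [i]) = (\<Sum>w\<in>(\<lambda>i. [i]) ` letters d. pmf \<mu> w)"
    by (subst sum.reindex) (auto simp: inj_on_def)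
  also have "\<dots> = 1" using set_pmf_Delta by (intro sum_pmf_eq_1) auto
  finally show ?thesis .
qed

lemma pmf_Delta_pos:
  assumes b: "b \<in> letters d" shows "0 < pmf \<mu> [b]"
proof (rule ccontr)
  assume "\<not> 0 < pmf \<mu> [b]"
  then have "pmf \<mu> [b] = 0" "pmf \<mu> [- b] = 0"
    using pmf_nonneg[of \<mu> "[b]"] pmf_Delta_uminus[OF b] by auto
  then have nb: "[b] \<notin> set_pmf \<mu>" "[- b] \<notin> set_pmf \<mu>" by (auto simp: set_pmf_iff)
  have "b \<notin> set w \<and> - b \<notin> set w" if "w \<in> generate (free_grp d) (set_pmf \<mu>)" for w
    using that
  proof induction
    case (inv h)
    with set_pmf_Delta obtain i where "h = [i]" "i \<in> letters d" by auto
    then show ?case using nb inv inv_letter by auto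
  next
    case (incl h)
    with set_pmf_Delta obtain i where "h = [i]" "i \<in> letters d" by auto
    then show ?case using nb incl by auto
  next
    case (eng h1 h2)
    then show ?case using set_foldr_mult_letter[of h1 h2] by (auto simp: free_grp_def)
  qed (simp add: free_grp_def)
  moreover have "[b] \<in> generate (free_grp d) (set_pmf \<mu>)"
    using \<mu> letter_carrier[OF b] by (simp add: Delta_def)
  ultimately show False by force
qed

lemma nn_integral_Delta:
  "(\<integral>\<^sup>+ g. F g \<partial>measure_pmf \<mu>) = (\<Sum>i\<in>letters d. ennreal (pmf \<mu> [i]) * F [i])"
proof -
  have "(\<integral>\<^sup>+ g. F g \<partial>measure_pmf \<mu>) = (\<Sum>g\<in>(\<lambda>i. [i]) ` letters d. F g * ennreal (pmf \<mu> g))"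
    using set_pmf_Delta by (intro nn_integral_measure_pmf_support) auto
  also have "\<dots> = (\<Sum>i\<in>letters d. ennreal (pmf \<mu> [i]) * F [i])"
    by (subst sum.reindex) (auto simp: inj_on_def mult.commute)
  finally show ?thesis .
qed

text \<open>
  Stationarity only has to be checked on cylinders.
\<close>

lemma stationary_iff:
  assumes \<nu>: "\<nu> \<in> boundary_probs d"
  shows "stationary d \<mu> \<nu> \<longleftrightarrow> (\<forall>a\<in>letters d. \<forall>w. measure \<nu> (cyl d (a # w)) =
    pmf \<mu> [a] * measure \<nu> (cyl d w - cyl d [- a])
      + (\<Sum>i\<in>letters d - {a}. pmf \<mu> [i] * measure \<nu> (cyl d (- i # a # w))))" (is "_ \<longleftrightarrow> ?R")
proof -
  interpret \<nu>: prob_space \<nu> using boundary_probsD[OF \<nu>] by simp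
  have conv: "(\<integral>\<^sup>+ g. emeasure (translate d g \<nu>) (cyl d (a # w)) \<partial>measure_pmf \<mu>) =
      ennreal (pmf \<mu> [a] * measure \<nu> (cyl d w - cyl d [- a])
      + (\<Sum>i\<in>letters d - {a}. pmf \<mu> [i] * measure \<nu> (cyl d (- i # a # w))))" (is "?L = _")
    if a: "a \<in> letters d" for a w
  proof -
    have "?L = (\<Sum>i\<in>letters d. ennreal (pmf \<mu> [i] *
        measure \<nu> (if i = a then cyl d w - cyl d [- a] else cyl d (- i # a # w))))"
      unfolding nn_integral_Delta
      by (intro sum.cong) (simp_all add: emeasure_translate_cyl[OF \<nu> _ a] \<nu>.emeasure_eq_measure ennreal_mult)
    also have "\<dots> = ennreal (\<Sum>i\<in>letters d. pmf \<mu> [i] *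
        measure \<nu> (if i = a then cyl d w - cyl d [- a] else cyl d (- i # a # w)))"
      by (intro sum_ennreal) simp
    also have "(\<Sum>i\<in>letters d. pmf \<mu> [i] *
        measure \<nu> (if i = a then cyl d w - cyl d [- a] else cyl d (- i # a # w))) =
       pmf \<mu> [a] * measure \<nu> (cyl d w - cyl d [- a]) + (\<Sum>i\<in>letters d - {a}. pmf \<mu> [i] * measure \<nu> (cyl d (- i # a # w)))"
      using a by (subst sum.remove[of _ a]) (auto intro!: sum.cong)
    finally show ?thesis .
  qed
  show ?thesis
  proof
    assume st: "stationary d \<mu> \<nu>"
    show ?R
    proof (intro ballI allI)
      fix a w assume a: "a \<in> letters d"
      have "emeasure \<nu> (cyl d (a # w)) = (\<integral>\<^sup>+ g. emeasure (translate d g \<nu>) (cyl d (a # w)) \<partial>measure_pmf \<mu>)"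
        using st unfolding stationary_def by simp
      then show "measure \<nu> (cyl d (a # w)) =
    pmf \<mu> [a] * measure \<nu> (cyl d w - cyl d [- a])
      + (\<Sum>i\<in>letters d - {a}. pmf \<mu> [i] * measure \<nu> (cyl d (- i # a # w)))"
        unfolding conv[OF a] \<nu>.emeasure_eq_measure
        by (subst (asm) ennreal_inj) (auto intro!: add_nonneg_nonneg sum_nonneg)
    qed
  next
    assume R: ?R
    \<comment> \<open>Off the support of \<open>\<mu>\<close> the kernel may be chosen freely; \<open>\<nu>\<close> keeps it a probability kernel.\<close>
    define K where "K g = (if g \<in> set_pmf \<mu> then translate d g \<nu> else \<nu>)" for g
    define N where "N = measure_pmf \<mu> \<bind> K"
    have KP: "K g \<in> boundary_probs d" for g
      using set_pmf_Delta translate_boundary_probs[OF \<nu>] \<nu> by (auto simp: K_def)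
    then have "K g \<in> space (subprob_algebra (boundary_borel d))" for g
      using boundary_probsD(1,2)[OF KP[of g]] by (simp add: space_subprob_algebra prob_space_imp_subprob_space)
    then have K: "K \<in> measure_pmf \<mu> \<rightarrow>\<^sub>M subprob_algebra (boundary_borel d)" by simp
    have sN: "sets N = sets (boundary_borel d)"
      unfolding N_def using boundary_probsD(2)[OF KP] by (intro sets_bind) auto
    have em: "emeasure N A = (\<integral>\<^sup>+ g. emeasure (translate d g \<nu>) A \<partial>measure_pmf \<mu>)"
      if "A \<in> sets (boundary_borel d)" for A
      unfolding N_def using that
      by (subst emeasure_bind[OF _ K]) (auto intro!: nn_integral_cong_AE AE_pmfI simp: K_def)
    have "\<nu> = N"
    proof (rule measure_eqI_cyl[OF boundary_probsD(2)[OF \<nu>] sN \<nu>.finite_measure_axioms])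
      fix a w assume a: "a \<in> letters d"
      show "emeasure \<nu> (cyl d (a # w)) = emeasure N (cyl d (a # w))"
        using R a by (simp only: em sets_cyl conv[OF a] \<nu>.emeasure_eq_measure)
    qed
    then show "stationary d \<mu> \<nu>" unfolding stationary_def using \<nu> em by simp
  qed
qed

end

lemma sum_measure_cyl_replicate_le:
  assumes \<nu>: "\<nu> \<in> boundary_probs d" and ab: "a \<noteq> b"
  shows "(\<Sum>k<N. measure \<nu> (cyl d (replicate k b @ a # w))) \<le> 1"
proof -
  interpret prob_space \<nu> using boundary_probsD[OF \<nu>] by simp
  have disj: "cyl d (replicate k b @ a # w) \<inter> cyl d (replicate l b @ a # w) = {}" if "k < l" for k l
  proof -
    have "\<xi> k = a" if "\<xi> \<in> cyl d (replicate k b @ a # w)" for \<xi>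
      using that by (auto simp: cyl_def nth_append dest!: spec[of _ k])
    moreover have "\<xi> k = b" if "\<xi> \<in> cyl d (replicate l b @ a # w)" for \<xi>
      using that \<open>k < l\<close> by (auto simp: cyl_def nth_append dest!: spec[of _ k])
    ultimately show ?thesis using ab by fastforce
  qed
  have "disjoint_family_on (\<lambda>k. cyl d (replicate k b @ a # w)) {..<N}"
    unfolding disjoint_family_on_def
  proof (intro ballI impI)
    fix k l :: nat assume "k \<noteq> l"
    then show "cyl d (replicate k b @ a # w) \<inter> cyl d (replicate l b @ a # w) = {}"
      using disj[of k l] disj[of l k] by (cases "k < l") auto
  qed
  then have "(\<Sum>k<N. measure \<nu> (cyl d (replicate k b @ a # w))) =
      measure \<nu> (\<Union>k<N. cyl d (replicate k b @ a # w))"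
    by (intro finite_measure_finite_Union[symmetric]) (simp_all add: boundary_probsD[OF \<nu>] image_subset_iff)
  then show ?thesis by simp
qed

text \<open>
  On cylinders the difference \<open>u\<close> of two stationary measures has a subharmonic modulus.  If its supremum
  \<open>D\<close> were positive, a word \<open>v\<close> at which \<open>u\<close> is nearly extremal could be prolonged on the left by
  \<open>b, bb, bbb, \<dots>\<close>, with \<open>u\<close> remaining at least \<open>D / 2\<close> in modulus.  These cylinders are disjoint, so
  enough of them contradict the finite total mass.  A letter \<open>b\<close> different from the first letter of
  \<open>v\<close> and from its inverse exists because the rank is at least two.
\<close>

lemma stationary_unique:
  assumes d: "2 \<le> d" and \<mu>: "\<mu> \<in> Delta d"
    and st: "stationary d \<mu> \<nu>" "stationary d \<mu> \<nu>'"
  shows "\<nu> = \<nu>'"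
proof -
  have \<nu>: "\<nu> \<in> boundary_probs d" and \<nu>': "\<nu>' \<in> boundary_probs d"
    using st by (simp_all add: stationary_def)
  interpret \<nu>: prob_space \<nu> using boundary_probsD[OF \<nu>] by simp
  interpret \<nu>': prob_space \<nu>' using boundary_probsD[OF \<nu>'] by simp
  define u where "u w = measure \<nu> (cyl d w) - measure \<nu>' (cyl d w)" for w
  define D where "D = (SUP v\<in>{v. v \<noteq> []}. \<bar>u v\<bar>)"
  have "\<bar>u v\<bar> \<le> 1" for v
    unfolding u_def using \<nu>.prob_le_1[of "cyl d v"] \<nu>'.prob_le_1[of "cyl d v"]
      measure_nonneg[of \<nu> "cyl d v"] measure_nonneg[of \<nu>' "cyl d v"] by linarith
  then have bdd: "bdd_above ((\<lambda>v. \<bar>u v\<bar>) ` {v. v \<noteq> []})" by (auto intro!: bdd_aboveI)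
  have uD: "\<bar>u (a # w)\<bar> \<le> D" for a w
    unfolding D_def by (rule cSUP_upper[OF _ bdd]) simp
  have D0: "0 \<le> D" using uD[of 0 "[]"] by linarith
  have sub: "pmf \<mu> [- b] * (D - \<bar>u (b # a # w)\<bar>) \<le> D - \<bar>u (a # w)\<bar>"
    if a: "a \<in> letters d" and b: "b \<in> letters d" "a \<noteq> - b" for a b w
  proof -
    define t where "t = measure \<nu> (cyl d w - cyl d [- a]) - measure \<nu>' (cyl d w - cyl d [- a])"
    have t: "\<bar>t\<bar> \<le> D"
    proof (cases w)
      case Nil
      then have "t = - u [- a]"
        unfolding t_def u_def Nil measure_boundary_diff_cyl[OF \<nu>] measure_boundary_diff_cyl[OF \<nu>'] by simp
      then show ?thesis using uD[of "- a" "[]"] by simp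
    next
      case (Cons c w')
      show ?thesis
      proof (cases "c = - a")
        case True
        then have "cyl d w - cyl d [- a] = {}" unfolding Cons by (auto simp: cyl_def)
        then have "t = 0" by (simp only: t_def measure_empty diff_self)
        then show ?thesis using D0 by simp
      next
        case False
        then have "cyl d w - cyl d [- a] = cyl d w" unfolding Cons by (auto simp: cyl_def)
        then show ?thesis using uD[of c w'] by (simp add: t_def u_def Cons)
      qed
    qed
    have eq: "u (a # w) = pmf \<mu> [a] * t + (\<Sum>i\<in>letters d - {a}. pmf \<mu> [i] * u (- i # a # w))"
      using st[unfolded stationary_iff[OF \<mu> \<nu>] stationary_iff[OF \<mu> \<nu>']] a
      by (simp add: u_def t_def right_diff_distrib sum_subtractf)
    have mb: "- b \<in> letters d - {a}" using b by auto
    have "\<bar>u (a # w)\<bar> \<le> pmf \<mu> [a] * \<bar>t\<bar> + (\<Sum>i\<in>letters d - {a}. pmf \<mu> [i] * \<bar>u (- i # a # w)\<bar>)"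
      unfolding eq
      by (rule order_trans[OF abs_triangle_ineq], rule add_mono)
         (auto simp: abs_mult intro!: order_trans[OF sum_abs])
    also have "\<dots> \<le> pmf \<mu> [a] * D + (pmf \<mu> [- b] * \<bar>u (b # a # w)\<bar>
        + (\<Sum>i\<in>letters d - {a} - {- b}. pmf \<mu> [i] * D))"
      using t mb uD by (subst sum.remove[OF _ mb]) (auto intro!: add_mono sum_mono mult_left_mono)
    also have "\<dots> = D * (\<Sum>i\<in>letters d. pmf \<mu> [i]) - pmf \<mu> [- b] * (D - \<bar>u (b # a # w)\<bar>)"
      using a mb by (subst sum.remove[of "letters d" a], simp, simp, subst sum.remove[OF _ mb])
        (auto simp: algebra_simps sum_distrib_left)
    finally show ?thesis using sum_pmf_Delta[OF \<mu>] by simp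
  qed
  have "D \<le> 0"
  proof (rule ccontr)
    assume "\<not> D \<le> 0"
    then have D: "0 < D" by simp
    define p where "p = Min ((\<lambda>i. pmf \<mu> [i]) ` letters d)"
    have ne: "letters d \<noteq> {}" using d by (auto simp: letters_def intro!: exI[of _ 1])
    then have p0: "0 < p" unfolding p_def using pmf_Delta_pos[OF \<mu>] by (subst Min_gr_iff) auto
    have ple: "p \<le> pmf \<mu> [i]" if "i \<in> letters d" for i unfolding p_def using that by auto
    have p1: "p \<le> 1" using ne ple pmf_le_1 by (meson all_not_in_conv order_trans)
    obtain N :: nat where N: "4 / D < real N" using reals_Archimedean2 by blast
    have "p ^ N * D / 2 > 0" using p0 D by simp
    then have "D - p ^ N * D / 2 < D" by simp
    moreover have "{v::int list. v \<noteq> []} \<noteq> {}" by blast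
    ultimately obtain v where v: "v \<noteq> []" "D - p ^ N * D / 2 < \<bar>u v\<bar>"
      using less_cSUP_iff[OF _ bdd, of "D - p ^ N * D / 2", folded D_def] by blast
    then obtain a w where vaw: "v = a # w" by (cases v) auto
    have "p ^ N \<le> 1" using p0 p1 by (simp add: power_le_one)
    then have "p ^ N * D / 2 \<le> D / 2" using D by (simp add: mult_left_le_one_le)
    then have "u v \<noteq> 0" using v D by auto
    moreover have "u v = 0" if "a \<notin> letters d"
      unfolding u_def vaw cyl_empty_letter[OF that] by simp
    ultimately have a: "a \<in> letters d" by blast
    define b :: int where "b = (if \<bar>a\<bar> = 1 then 2 else 1)"
    have b: "b \<in> letters d" "a \<noteq> b" "a \<noteq> - b" using d by (auto simp: b_def letters_def split: if_splits)
    have iter: "p ^ k * (D - \<bar>u (replicate k b @ a # w)\<bar>) \<le> D - \<bar>u (a # w)\<bar>" for k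
    proof (induction k)
      case (Suc k)
      obtain h t where ht: "replicate k b @ a # w = h # t" "h = a \<or> h = b"
        by (cases k) auto
      have "pmf \<mu> [- b] * (D - \<bar>u (b # h # t)\<bar>) \<le> D - \<bar>u (h # t)\<bar>"
        using ht a b letters_nonzero[OF b(1)] by (intro sub) auto
      moreover have "p * (D - \<bar>u (b # h # t)\<bar>) \<le> pmf \<mu> [- b] * (D - \<bar>u (b # h # t)\<bar>)"
        using ple[of "- b"] b uD[of b "h # t"] by (intro mult_right_mono) auto
      ultimately have "p * (D - \<bar>u (b # h # t)\<bar>) \<le> D - \<bar>u (h # t)\<bar>" by linarith
      then have "p ^ k * (p * (D - \<bar>u (b # h # t)\<bar>)) \<le> p ^ k * (D - \<bar>u (h # t)\<bar>)"
        using p0 by (intro mult_left_mono) auto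
      with Suc.IH show ?case by (simp add: ht mult_ac)
    qed simp
    have large: "D / 2 \<le> \<bar>u (replicate k b @ a # w)\<bar>" if k: "k < N" for k
    proof -
      have "p ^ N \<le> p ^ k" using k p0 p1 by (intro power_decreasing) auto
      then have "p ^ N * (D / 2) \<le> p ^ k * (D / 2)" using D by (intro mult_right_mono) auto
      then have "p ^ k * (D - \<bar>u (replicate k b @ a # w)\<bar>) \<le> p ^ k * (D / 2)"
        using iter[of k] v(2) unfolding vaw by linarith
      then have "D - \<bar>u (replicate k b @ a # w)\<bar> \<le> D / 2"
        using p0 by (simp add: mult_le_cancel_left_pos)
      then show ?thesis by linarith
    qed
    have "real N * (D / 2) = (\<Sum>k<N. D / 2)" by simp
    also have "\<dots> \<le> (\<Sum>k<N. \<bar>u (replicate k b @ a # w)\<bar>)" using large by (intro sum_mono) simp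
    also have "\<dots> \<le> (\<Sum>k<N. measure \<nu> (cyl d (replicate k b @ a # w))
        + measure \<nu>' (cyl d (replicate k b @ a # w)))"
      unfolding u_def by (intro sum_mono) (simp add: abs_le_iff)
    also have "\<dots> \<le> 1 + 1"
      unfolding sum.distrib by (intro add_mono sum_measure_cyl_replicate_le \<nu> \<nu>' b)
    finally show False using N D by (simp add: field_simps)
  qed
  then have "u (a # w) = 0" for a w using uD[of a w] by linarith
  then show ?thesis
    by (intro measure_eqI_cyl[OF boundary_probsD(2)[OF \<nu>] boundary_probsD(2)[OF \<nu>'] \<nu>.finite_measure_axioms])
       (simp add: u_def \<nu>.emeasure_eq_measure \<nu>'.emeasure_eq_measure)
qed

section \<open>The hitting probabilities\<close>

text \<open>
  A solution in \<open>(0, 1)\<close> of the equations of the hitting probabilities; values outside the letters are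
  left unrestricted.
\<close>

definition hitting_solution :: "nat \<Rightarrow> int list pmf \<Rightarrow> (int \<Rightarrow> real) \<Rightarrow> bool" where
  "hitting_solution d \<mu> q \<longleftrightarrow> (\<forall>j\<in>letters d. q j \<in> {0<..<1} \<and>
     q j = pmf \<mu> [j] + q j * (\<Sum>i \<in> letters d - {j}. pmf \<mu> [i] * q (- i)))"

context
  fixes d :: nat and \<mu> :: "int list pmf"
  assumes d: "2 \<le> d" and \<mu>: "\<mu> \<in> Delta d"
begin

text \<open>
  A solution is symmetric, and by the last identity it is determined by the single
  number \<open>x\<close>.
\<close>

lemma hitting_solution_facts:
  assumes q: "hitting_solution d \<mu> q"
  defines "x \<equiv> 1 - (\<Sum>i\<in>letters d. pmf \<mu> [i] * q i)"
  shows "0 < x"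
    and "\<And>j. j \<in> letters d \<Longrightarrow> q (- j) = q j"
    and "\<And>j. j \<in> letters d \<Longrightarrow> pmf \<mu> [j] * (1 - q j * q j) = x * q j"
proof -
  define S where "S = (\<Sum>i\<in>letters d. pmf \<mu> [i] * q (- i))"
  have q01: "0 < q j" "q j < 1" if "j \<in> letters d" for j
    using q that by (auto simp: hitting_solution_def)
  have ne: "letters d \<noteq> {}" using d by (auto simp: letters_def intro!: exI[of _ 1])
  have "S < (\<Sum>i\<in>letters d. pmf \<mu> [i])"
    unfolding S_def
  proof (rule sum_strict_mono)
    fix i assume i: "i \<in> letters d"
    then have "pmf \<mu> [i] * q (- i) < pmf \<mu> [i] * 1"
      using pmf_Delta_pos[OF \<mu> i] q01[of "- i"] by (intro mult_strict_left_mono) auto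
    then show "pmf \<mu> [i] * q (- i) < pmf \<mu> [i]" by simp
  qed (use ne in auto)
  then have S1: "S < 1" by (simp add: sum_pmf_Delta[OF \<mu>])
  have eq: "(1 - S) * q j = pmf \<mu> [j] * (1 - q j * q (- j))" if j: "j \<in> letters d" for j
  proof -
    have "S = pmf \<mu> [j] * q (- j) + (\<Sum>i \<in> letters d - {j}. pmf \<mu> [i] * q (- i))"
      unfolding S_def using j by (simp add: sum.remove)
    moreover have "q j = pmf \<mu> [j] + q j * (\<Sum>i \<in> letters d - {j}. pmf \<mu> [i] * q (- i))"
      using q j unfolding hitting_solution_def by blast
    ultimately have "q j = pmf \<mu> [j] + q j * (S - pmf \<mu> [j] * q (- j))" by simp
    then show ?thesis by (simp add: algebra_simps)
  qed
  show sym: "q (- j) = q j" if j: "j \<in> letters d" for j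
  proof -
    have "(1 - S) * q (- j) = (1 - S) * q j"
      using eq[of j] eq[of "- j"] j pmf_Delta_uminus[OF \<mu> j] by (simp add: mult.commute)
    then show ?thesis using S1 by simp
  qed
  have "S = 1 - x" unfolding S_def x_def using sym by (auto intro!: sum.cong)
  then show "0 < x" using S1 by simp
  show "pmf \<mu> [j] * (1 - q j * q j) = x * q j" if "j \<in> letters d" for j
    using \<open>S = 1 - x\<close> eq[OF that] sym[OF that] by simp
qed

lemma hitting_solution_sum:
  assumes q: "hitting_solution d \<mu> q"
  shows "(\<Sum>j\<in>letters d. q j / (1 + q j)) = 1"
proof -
  define x where "x = 1 - (\<Sum>i\<in>letters d. pmf \<mu> [i] * q i)"
  note f = hitting_solution_facts[OF q, folded x_def]
  have "q j / (1 + q j) = (pmf \<mu> [j] - pmf \<mu> [j] * q j) / x" if j: "j \<in> letters d" for j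
  proof -
    have "0 < 1 + q j" using q j by (auto simp: hitting_solution_def intro: add_pos_pos)
    moreover have "x * q j = (pmf \<mu> [j] - pmf \<mu> [j] * q j) * (1 + q j)"
      using f(3)[OF j] by (simp add: algebra_simps)
    ultimately show ?thesis using f(1) by (simp add: divide_eq_eq eq_divide_eq mult.commute)
  qed
  then have "(\<Sum>j\<in>letters d. q j / (1 + q j)) = (\<Sum>j\<in>letters d. pmf \<mu> [j] - pmf \<mu> [j] * q j) / x"
    unfolding sum_divide_distrib by (rule sum.cong[OF refl])
  also have "\<dots> = 1" using f(1) by (simp add: sum_subtractf sum_pmf_Delta[OF \<mu>] x_def)
  finally show ?thesis .
qed

text \<open>
  Solutions are strictly decreasing in \<open>x\<close>, and so is the sum in
  \<open>hitting_solution_sum\<close>; hence two solutions share the same \<open>x\<close>.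
\<close>

lemma hitting_solution_unique:
  assumes q: "hitting_solution d \<mu> q" and q': "hitting_solution d \<mu> q'" and j: "j \<in> letters d"
  shows "q j = q' j"
proof -
  define x where "x r = 1 - (\<Sum>i\<in>letters d. pmf \<mu> [i] * r i)" for r :: "int \<Rightarrow> real"
  have less: "r' i < r i" if r: "hitting_solution d \<mu> r" "hitting_solution d \<mu> r'"
      and i: "i \<in> letters d" and x: "x r < x r'" for r r' i
  proof (rule ccontr)
    assume "\<not> r' i < r i"
    then have le: "r i \<le> r' i" by simp
    have r0: "0 < r i" "0 < r' i" using r i by (auto simp: hitting_solution_def)
    have "x r * r i < x r' * r' i"
      using x le r0 hitting_solution_facts(1)[OF r(1)] by (intro mult_less_le_imp_less) (auto simp: x_def)
    moreover have "pmf \<mu> [i] * (1 - r' i * r' i) \<le> pmf \<mu> [i] * (1 - r i * r i)"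
      using le r0 by (intro mult_left_mono) (auto intro: mult_mono)
    ultimately show False
      using hitting_solution_facts(3)[OF r(1) i] hitting_solution_facts(3)[OF r(2) i] by (simp add: x_def)
  qed
  have ne: "letters d \<noteq> {}" using j by auto
  have nless: "\<not> x r < x r'" if r: "hitting_solution d \<mu> r" "hitting_solution d \<mu> r'" for r r'
  proof
    assume x: "x r < x r'"
    have "(\<Sum>j\<in>letters d. r' j / (1 + r' j)) < (\<Sum>j\<in>letters d. r j / (1 + r j))"
    proof (rule sum_strict_mono)
      fix i assume i: "i \<in> letters d"
      have "0 < r i" "0 < r' i" using r i by (auto simp: hitting_solution_def)
      then show "r' i / (1 + r' i) < r i / (1 + r i)" using less[OF r i x] by (simp add: field_simps)
    qed (use ne in auto)
    then show False using r by (simp add: hitting_solution_sum)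
  qed
  have xx: "x q = x q'" using nless[OF q q'] nless[OF q' q] by simp
  have "q j < q' j \<or> q' j < q j \<Longrightarrow> False"
  proof -
    have p: "0 < pmf \<mu> [j]" using pmf_Delta_pos[OF \<mu> j] .
    have q0: "0 < q j" "0 < q' j" using q q' j by (auto simp: hitting_solution_def)
    have x0: "0 < x q" using hitting_solution_facts(1)[OF q] by (simp add: x_def)
    have e: "pmf \<mu> [j] * (1 - q j * q j) = x q * q j" "pmf \<mu> [j] * (1 - q' j * q' j) = x q * q' j"
      using hitting_solution_facts(3)[OF q j] hitting_solution_facts(3)[OF q' j]
      by (simp_all add: x_def[symmetric] xx)
    then have "(q j - q' j) * (pmf \<mu> [j] * (q j + q' j) + x q) = 0" by (simp add: algebra_simps)
    moreover have "0 < pmf \<mu> [j] * (q j + q' j) + x q" using p q0 x0 by (simp add: add_pos_pos)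
    ultimately show "q j < q' j \<or> q' j < q j \<Longrightarrow> False" by simp
  qed
  then show ?thesis by (cases "q j" "q' j" rule: linorder_cases) auto
qed

lemma hitting_solution_exists: "\<exists>q. hitting_solution d \<mu> q"
proof -
  define p where "p i = pmf \<mu> [i]" for i
  have p0: "0 < p i" if "i \<in> letters d" for i using pmf_Delta_pos[OF \<mu> that] by (simp add: p_def)
  have psum: "(\<Sum>i\<in>letters d. p i) = 1" using sum_pmf_Delta[OF \<mu>] by (simp add: p_def)
  \<comment> \<open>Solving the quadratic equation for \<open>q\<^sub>j\<close> in terms of \<open>x\<close> turns \<open>\<Sum> p\<^sub>j q\<^sub>j = 1 - x\<close> into \<open>F x = 0\<close>.
    The root \<open>x = 0\<close> corresponds to \<open>q = 1\<close>; a positive root comes from \<open>F z \<le> 0 \<le> F 1\<close> for small \<open>z\<close>.\<close>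
  define F where "F x = (\<Sum>i\<in>letters d. sqrt (x\<^sup>2 + 4 * (p i)\<^sup>2) - x) + 2 * x - 2" for x
  define C where "C = (\<Sum>i\<in>letters d. 1 / (4 * p i))"
  have ne: "letters d \<noteq> {}" using d by (auto simp: letters_def intro!: exI[of _ 1])
  have C: "0 < C" unfolding C_def using ne p0 by (intro sum_pos) auto
  have "{1, - 1, 2, - 2} \<subseteq> letters d" using d by (auto simp: letters_def)
  then have "card {1, - 1, 2, - 2 :: int} \<le> card (letters d)" by (intro card_mono) auto
  then have card: "4 \<le> real (card (letters d))" by simp
  define z where "z = min (1/2) (1 / C)"
  have z: "0 < z" "z \<le> 1" "C * z \<le> 1" using C by (auto simp: z_def min_def field_simps)
  have Fz: "F z \<le> 0"
  proof -
    have "sqrt (z\<^sup>2 + 4 * (p i)\<^sup>2) - z \<le> 2 * p i + z\<^sup>2 * (1 / (4 * p i)) - z" if i: "i \<in> letters d" for i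
    proof -
      have "(2 * p i + z\<^sup>2 / (4 * p i))\<^sup>2 = z\<^sup>2 + 4 * (p i)\<^sup>2 + (z\<^sup>2 / (4 * p i))\<^sup>2"
        using p0[OF i] by (simp add: power2_sum power_mult_distrib)
      then have "z\<^sup>2 + 4 * (p i)\<^sup>2 \<le> (2 * p i + z\<^sup>2 / (4 * p i))\<^sup>2" by simp
      then have "sqrt (z\<^sup>2 + 4 * (p i)\<^sup>2) \<le> 2 * p i + z\<^sup>2 / (4 * p i)"
        using p0[OF i] by (intro real_le_lsqrt) auto
      then show ?thesis by simp
    qed
    then have "F z \<le> (\<Sum>i\<in>letters d. 2 * p i + z\<^sup>2 * (1 / (4 * p i)) - z) + 2 * z - 2"
      unfolding F_def by (intro add_mono diff_mono sum_mono) auto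
    also have "\<dots> = 2 + z\<^sup>2 * C - real (card (letters d)) * z + 2 * z - 2"
      by (simp only: sum.distrib sum_subtractf psum C_def sum_constant flip: sum_distrib_left)
    also have "\<dots> = z * (C * z) - real (card (letters d)) * z + 2 * z"
      by (simp add: power2_eq_square algebra_simps)
    also have "\<dots> \<le> z * 1 - 4 * z + 2 * z"
      using z card by (intro add_mono diff_mono mult_left_mono mult_right_mono) auto
    also have "\<dots> \<le> 0" using z by simp
    finally show ?thesis .
  qed
  have F1: "0 \<le> F 1"
    unfolding F_def by (auto intro!: sum_nonneg)
  have "\<exists>x. z \<le> x \<and> x \<le> 1 \<and> F x = 0"
    using Fz F1 z unfolding F_def by (intro IVT') (auto intro!: continuous_intros)
  then obtain x where x: "z \<le> x" "F x = 0" by blast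
  have x0: "0 < x" using z x by simp
  define q where "q j = (sqrt (x\<^sup>2 + 4 * (p j)\<^sup>2) - x) / (2 * p j)" for j
  have sumq: "(\<Sum>i\<in>letters d. p i * q i) = 1 - x"
  proof -
    have "(\<Sum>i\<in>letters d. p i * q i) = (\<Sum>i\<in>letters d. (sqrt (x\<^sup>2 + 4 * (p i)\<^sup>2) - x) / 2)"
      using p0 by (intro sum.cong) (auto simp: q_def less_le)
    also have "\<dots> = 1 - x"
      using x(2) unfolding F_def sum_divide_distrib[symmetric] by simp
    finally show ?thesis .
  qed
  have sym: "q (- j) = q j" if "j \<in> letters d" for j
    using pmf_Delta_uminus[OF \<mu> that] by (simp add: q_def p_def)
  have "hitting_solution d \<mu> q"
    unfolding hitting_solution_def
  proof (intro ballI conjI)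
    fix j assume j: "j \<in> letters d"
    define s where "s = sqrt (x\<^sup>2 + 4 * (p j)\<^sup>2)"
    have s2: "s\<^sup>2 = x\<^sup>2 + 4 * (p j)\<^sup>2" by (simp add: s_def)
    have "x < s" unfolding s_def using p0[OF j] x0 by (intro real_less_rsqrt) auto
    moreover have "s < x + 2 * p j"
      unfolding s_def using p0[OF j] x0 by (intro real_less_lsqrt) (auto simp: power2_sum power_mult_distrib)
    ultimately show "q j \<in> {0<..<1}" using p0[OF j] by (simp add: q_def s_def[symmetric])
    have "p j * (q j)\<^sup>2 + x * q j = p j"
    proof -
      have "s = 2 * p j * q j + x" using p0[OF j] by (simp add: q_def s_def[symmetric])
      then have "4 * p j * (p j * (q j)\<^sup>2 + x * q j) = 4 * p j * p j"
        using s2 by (simp add: power2_eq_square algebra_simps)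
      then show ?thesis using p0[OF j] by simp
    qed
    moreover have others: "(\<Sum>i\<in>letters d - {j}. p i * q (- i)) = 1 - x - p j * q j"
      using sumq j sym by (subst (asm) sum.remove[of _ j]) auto
    ultimately show "q j = pmf \<mu> [j] + q j * (\<Sum>i \<in> letters d - {j}. pmf \<mu> [i] * q (- i))"
      unfolding p_def[symmetric] others by (simp add: power2_eq_square algebra_simps)
  qed
  then show ?thesis by blast
qed

lemma hitting_solution_hitting: "hitting_solution d \<mu> (hitting d \<mu>)"
proof -
  obtain q where q: "hitting_solution d \<mu> q" using hitting_solution_exists by blast
  define q' where "q' = restrict q (letters d)"
  have sol: "r \<in> letters d \<rightarrow>\<^sub>E {0<..<1} \<and>
     (\<forall>j \<in> letters d. r j = pmf \<mu> [j] + r j * (\<Sum>i \<in> letters d - {j}. pmf \<mu> [i] * r (- i)))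
     \<longleftrightarrow> r \<in> extensional (letters d) \<and> hitting_solution d \<mu> r" for r
    unfolding hitting_solution_def PiE_def Pi_def by blast
  have "hitting_solution d \<mu> q'"
    using q unfolding hitting_solution_def q'_def by simp
  then have "\<exists>!r. r \<in> extensional (letters d) \<and> hitting_solution d \<mu> r"
    by (intro ex1I[of _ q']) (auto simp: q'_def intro!: extensionalityI[of _ "letters d"] hitting_solution_unique)
  from theI'[OF this] show ?thesis unfolding hitting_def sol by blast
qed

end

section \<open>The harmonic measure\<close>

text \<open>
  The scaling property \<open>\<nu>(a A) = q\<^sub>a \<nu>(A)\<close> for sets \<open>A\<close> of words that do not begin with the inverse
  of \<open>a\<close>, restricted to cylinders.
\<close>

definition conformal :: "nat \<Rightarrow> (int \<Rightarrow> real) \<Rightarrow> (nat \<Rightarrow> int) measure \<Rightarrow> bool" where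
  "conformal d q \<nu> \<longleftrightarrow> \<nu> \<in> boundary_probs d \<and>
     (\<forall>a\<in>letters d. \<forall>w. measure \<nu> (cyl d (a # w)) = q a * measure \<nu> (cyl d w - cyl d [- a]))"

lemma stationary_conformal:
  assumes \<mu>: "\<mu> \<in> Delta d" and q: "hitting_solution d \<mu> q" and \<nu>: "conformal d q \<nu>"
  shows "stationary d \<mu> \<nu>"
proof -
  have \<nu>P: "\<nu> \<in> boundary_probs d" and cf: "\<And>a w. a \<in> letters d \<Longrightarrow>
      measure \<nu> (cyl d (a # w)) = q a * measure \<nu> (cyl d w - cyl d [- a])"
    using \<nu> by (auto simp: conformal_def)
  show ?thesis unfolding stationary_iff[OF \<mu> \<nu>P]
  proof (intro ballI allI)
    fix a w assume a: "a \<in> letters d"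
    define m where "m = measure \<nu> (cyl d w - cyl d [- a])"
    have aw: "measure \<nu> (cyl d (a # w)) = q a * m" using cf[OF a] by (simp add: m_def)
    have step: "measure \<nu> (cyl d (- i # a # w)) = q (- i) * (q a * m)" if i: "i \<in> letters d - {a}" for i
    proof -
      have "cyl d (a # w) - cyl d [i] = cyl d (a # w)" using i by (auto simp: mem_cyl_Cons)
      then show ?thesis using cf[of "- i" "a # w"] i aw by simp
    qed
    have "pmf \<mu> [a] * m + (\<Sum>i\<in>letters d - {a}. pmf \<mu> [i] * measure \<nu> (cyl d (- i # a # w)))
        = pmf \<mu> [a] * m + (\<Sum>i\<in>letters d - {a}. pmf \<mu> [i] * q (- i)) * (q a * m)"
      by (simp add: step sum_distrib_right mult.assoc)
    also have "\<dots> = (pmf \<mu> [a] + q a * (\<Sum>i\<in>letters d - {a}. pmf \<mu> [i] * q (- i))) * m"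
      by (simp add: algebra_simps)
    also have "\<dots> = q a * m" using q a unfolding hitting_solution_def by metis
    finally show "measure \<nu> (cyl d (a # w)) = pmf \<mu> [a] * measure \<nu> (cyl d w - cyl d [- a])
        + (\<Sum>i\<in>letters d - {a}. pmf \<mu> [i] * measure \<nu> (cyl d (- i # a # w)))"
      by (simp add: aw m_def)
  qed
qed

lemma translate_conformal:
  assumes q: "\<And>j. j \<in> letters d \<Longrightarrow> 0 < q j" "\<And>j. j \<in> letters d \<Longrightarrow> q (- j) = q j"
    and \<nu>: "conformal d q \<nu>" and j: "j \<in> letters d"
  shows "translate d [j] \<nu> = density \<nu> (\<lambda>\<xi>. ennreal (if \<xi> 0 = j then 1 / q j else q j))"
proof -
  have \<nu>P: "\<nu> \<in> boundary_probs d" and cf: "\<And>a w. a \<in> letters d \<Longrightarrow>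
      measure \<nu> (cyl d (a # w)) = q a * measure \<nu> (cyl d w - cyl d [- a])"
    using \<nu> by (auto simp: conformal_def)
  interpret \<nu>: prob_space \<nu> using boundary_probsD[OF \<nu>P] by simp
  define r where "r \<xi> = (if \<xi> 0 = j then 1 / q j else q j)" for \<xi> :: "nat \<Rightarrow> int"
  have tP: "translate d [j] \<nu> \<in> boundary_probs d" by (rule translate_boundary_probs[OF \<nu>P j])
  have coord: "(\<lambda>\<xi>. \<xi> 0) \<in> \<nu> \<rightarrow>\<^sub>M (count_space UNIV :: int measure)"
    unfolding measurable_cong_sets[OF boundary_probsD(2)[OF \<nu>P] refl] by (rule measurable_coord)
  have rm: "r \<in> borel_measurable \<nu>"
    unfolding r_def[abs_def] by (rule measurable_compose[OF coord]) simp
  show ?thesis unfolding r_def[symmetric]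
  proof (rule measure_eqI_cyl[OF boundary_probsD(2)[OF tP]])
    show "sets (density \<nu> (\<lambda>\<xi>. ennreal (r \<xi>))) = sets (boundary_borel d)"
      using boundary_probsD(2)[OF \<nu>P] by simp
    show "finite_measure (translate d [j] \<nu>)"
      using boundary_probsD(1)[OF tP] by (rule prob_space.finite_measure)
    fix a w assume a: "a \<in> letters d"
    define s where "s = (if a = j then 1 / q j else q j)"
    have s0: "0 \<le> s" using q(1)[OF j] by (simp add: s_def)
    have cylm: "cyl d (a # w) \<in> sets \<nu>" using boundary_probsD(2)[OF \<nu>P] by simp
    have "emeasure (density \<nu> (\<lambda>\<xi>. ennreal (r \<xi>))) (cyl d (a # w)) =
        (\<integral>\<^sup>+\<xi>. ennreal (r \<xi>) * indicator (cyl d (a # w)) \<xi> \<partial>\<nu>)"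
      using rm cylm by (intro emeasure_density) simp_all
    also have "\<dots> = (\<integral>\<^sup>+\<xi>. ennreal s * indicator (cyl d (a # w)) \<xi> \<partial>\<nu>)"
      by (intro nn_integral_cong) (simp add: r_def s_def mem_cyl_Cons indicator_def)
    also have "\<dots> = ennreal (s * measure \<nu> (cyl d (a # w)))"
      using cylm s0 by (simp add: nn_integral_cmult_indicator \<nu>.emeasure_eq_measure ennreal_mult)
    also have "s * measure \<nu> (cyl d (a # w)) =
        measure \<nu> (if j = a then cyl d w - cyl d [- a] else cyl d (- j # a # w))"
    proof (cases "j = a")
      case True
      then show ?thesis using cf[OF a, of w] q(1)[OF j] by (simp add: s_def)
    next
      case False
      then have "cyl d (a # w) - cyl d [j] = cyl d (a # w)" by (auto simp: mem_cyl_Cons)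
      then show ?thesis using cf[of "- j" "a # w"] j False q(2)[OF j] by (simp add: s_def)
    qed
    finally show "emeasure (translate d [j] \<nu>) (cyl d (a # w)) =
        emeasure (density \<nu> (\<lambda>\<xi>. ennreal (r \<xi>))) (cyl d (a # w))"
      unfolding emeasure_translate_cyl[OF \<nu>P j a] \<nu>.emeasure_eq_measure by simp
  qed
qed

text \<open>
  A Markov chain of letters driven by a sequence \<open>\<omega>\<close> of maps: \<open>\<omega> n\<close> produces the
  letter number \<open>n\<close> from its predecessor, and the integer \<open>0\<close>, which is not a letter,
  serves as the state before the first letter.
\<close>

fun chain :: "(nat \<Rightarrow> int \<Rightarrow> int) \<Rightarrow> nat \<Rightarrow> int" where
  "chain \<omega> 0 = \<omega> 0 0"
| "chain \<omega> (Suc n) = \<omega> (Suc n) (chain \<omega> n)"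

lemma chain_eq_iff:
  "(\<forall>k<n. chain \<omega> k = w ! k) \<longleftrightarrow> (\<forall>k<n. \<omega> k ((0 # w) ! k) = w ! k)"
proof (induction n)
  case (Suc n)
  have "(chain \<omega> n = w ! n) = (\<omega> n ((0 # w) ! n) = w ! n)" if "\<forall>k<n. chain \<omega> k = w ! k"
    using that by (cases n) auto
  then show ?case using Suc.IH by (auto simp: less_Suc_eq)
qed simp

lemma cyl_empty_letters: "\<not> set w \<subseteq> letters d \<Longrightarrow> cyl d w = {}"
  unfolding cyl_def boundary_def by (auto simp: in_set_conv_nth) metis

text \<open>
  The chain starts in the distribution \<open>v\<^sub>j = q\<^sub>j / (1 + q\<^sub>j)\<close> and moves from \<open>i\<close> according to
  \<open>v\<close> conditioned on avoiding \<open>- i\<close>, an event of probability \<open>1 / (1 + q\<^sub>i)\<close>.  Choosing the maps independently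
  with these laws at each state realises the chain on a product space.
\<close>

lemma conformal_exists:
  assumes q0: "\<And>j. j \<in> letters d \<Longrightarrow> 0 < q j" and qs: "\<And>j. j \<in> letters d \<Longrightarrow> q (- j) = q j"
    and sum1: "(\<Sum>j\<in>letters d. q j / (1 + q j)) = 1"
  shows "\<exists>\<nu>. conformal d q \<nu>"
proof -
  define v where "v j = (if j \<in> letters d then q j / (1 + q j) else 0)" for j
  have v0: "0 \<le> v j" for j using q0[of j] by (auto simp: v_def)
  have "(\<integral>\<^sup>+ j. ennreal (v j) \<partial>count_space UNIV) = (\<Sum>j\<in>letters d. ennreal (v j))"
    by (rule nn_integral_count_space') (auto simp: v_def)
  also have "\<dots> = ennreal (\<Sum>j\<in>letters d. v j)" by (rule sum_ennreal) (rule v0)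
  also have "(\<Sum>j\<in>letters d. v j) = 1" using sum1 by (simp add: v_def)
  finally have nn1: "(\<integral>\<^sup>+ j. ennreal (v j) \<partial>count_space UNIV) = 1" by simp
  define V where "V = embed_pmf v"
  have pmfV: "pmf V j = v j" for j unfolding V_def by (rule pmf_embed_pmf[OF v0 nn1])
  have setV: "set_pmf V = letters d"
  proof (rule Set.set_eqI)
    fix j
    have "v j \<noteq> 0 \<longleftrightarrow> j \<in> letters d" using q0[of j] by (auto simp: v_def)
    then show "j \<in> set_pmf V \<longleftrightarrow> j \<in> letters d" by (simp add: set_pmf_iff pmfV)
  qed
  define K where "K i = (if i \<in> letters d then cond_pmf V {j. j \<noteq> - i} else V)" for i
  have Kne: "set_pmf V \<inter> {j. j \<noteq> - i} \<noteq> {}" if "i \<in> letters d" for i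
    using that letters_nonzero[OF that] unfolding setV by (intro ex_in_conv[THEN iffD1] exI[of _ i]) auto
  have setK: "set_pmf (K i) = (if i \<in> letters d then letters d - {- i} else letters d)" for i
    using Kne[of i] by (auto simp: K_def set_cond_pmf setV)
  have pmfK: "pmf (K i) j = v j * (1 + q i)" if i: "i \<in> letters d" and j: "j \<noteq> - i" for i j
  proof -
    have "measure V {j. j \<noteq> - i} = 1 - measure V {- i}"
      using measure_pmf.prob_compl[of "{- i}" V] by (simp add: Compl_eq_Diff_UNIV[symmetric] Collect_neg_eq)
    also have "\<dots> = 1 / (1 + q i)"
      using i q0[OF i] qs[OF i] by (simp add: measure_pmf_single pmfV v_def field_simps)
    finally show ?thesis using i j q0[OF i] Kne[OF i] by (simp add: K_def pmf_cond pmfV)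
  qed
  define I where "I = insert 0 (letters d)"
  have finI: "finite I" by (simp add: I_def)
  define Y where "Y = Pi_pmf I 0 K"
  have setY: "\<phi> i \<in> set_pmf (K i)" if "\<phi> \<in> set_pmf Y" "i \<in> I" for \<phi> i
    using that finI by (auto simp: Y_def set_Pi_pmf PiE_dflt_def)
  have emY: "emeasure (measure_pmf Y) {\<phi>. \<phi> i = j} = ennreal (pmf (K i) j)" if i: "i \<in> I" for i j
  proof -
    have "map_pmf (\<lambda>\<phi>. \<phi> i) Y = K i" unfolding Y_def using i by (subst Pi_pmf_component[OF finI]) simp
    then have "emeasure (measure_pmf (map_pmf (\<lambda>\<phi>. \<phi> i) Y)) {j} = ennreal (pmf (K i) j)"
      by (simp add: emeasure_pmf_single)
    then show ?thesis by (simp add: vimage_def)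
  qed
  define Pr where "Pr = (\<Pi>\<^sub>M n\<in>(UNIV :: nat set). measure_pmf Y)"
  interpret Pr: product_prob_space "\<lambda>n::nat. measure_pmf Y" UNIV by standard
  interpret P: prob_space Pr unfolding Pr_def by (rule Pr.prob_space_axioms)
  have spPr: "space Pr = UNIV" by (simp add: Pr_def space_PiM)
  have comp: "(\<lambda>\<omega>. \<omega> n i) \<in> Pr \<rightarrow>\<^sub>M (count_space UNIV :: int measure)" for n i
  proof -
    have "(\<lambda>\<omega>. \<omega> n) \<in> Pr \<rightarrow>\<^sub>M measure_pmf Y" unfolding Pr_def by (rule measurable_component_singleton) simp
    then show ?thesis by (rule measurable_compose) simp
  qed
  have chain_meas: "(\<lambda>\<omega>. chain \<omega> n) \<in> Pr \<rightarrow>\<^sub>M (count_space UNIV :: int measure)" for n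
  proof (induction n)
    case 0
    then show ?case using comp[of 0 0] by simp
  next
    case (Suc n)
    have "(\<lambda>\<omega>. (\<lambda>i \<omega>. \<omega> (Suc n) i) (chain \<omega> n) \<omega>) \<in> Pr \<rightarrow>\<^sub>M (count_space UNIV :: int measure)"
      by (rule measurable_compose_countable[OF comp Suc])
    then show ?case by simp
  qed
  have AEb: "AE \<omega> in Pr. chain \<omega> \<in> boundary d"
  proof -
    have "AE \<omega> in Pr. \<omega> n \<in> set_pmf Y" for n
      unfolding Pr_def by (rule AE_PiM_component[of UNIV "\<lambda>_. measure_pmf Y"])
        (auto simp: AE_measure_pmf measure_pmf.prob_space_axioms)
    then have "AE \<omega> in Pr. \<forall>n. \<omega> n \<in> set_pmf Y" by (simp add: AE_all_countable)
    then show ?thesis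
    proof eventually_elim
      case (elim \<omega>)
      have l: "chain \<omega> n \<in> letters d" for n
      proof (induction n)
        case 0
        then show ?case using setY[of "\<omega> 0" 0] elim by (auto simp: I_def setK letters_def)
      next
        case (Suc n)
        then show ?case using setY[of "\<omega> (Suc n)" "chain \<omega> n"] elim by (auto simp: I_def setK)
      qed
      moreover have "chain \<omega> (Suc n) \<noteq> - chain \<omega> n" for n
        using setY[of "\<omega> (Suc n)" "chain \<omega> n"] elim l[of n] by (auto simp: I_def setK)
      ultimately show ?case unfolding boundary_def by blast
    qed
  qed
  have "letters d \<noteq> {}" using sum1 by auto
  then have one: "1 \<in> letters d" by (auto simp: letters_def)
  \<comment> \<open>Off a null set the chain is replaced by a constant boundary point, so that the map is total.\<close>
  define X where "X \<omega> = (if chain \<omega> \<in> boundary d then chain \<omega> else (\<lambda>_. 1))" for \<omega>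
  have Xb: "X \<omega> \<in> boundary d" for \<omega> using one by (auto simp: X_def boundary_def)
  have "{\<omega> \<in> space Pr. chain \<omega> \<in> boundary d} \<in> sets Pr"
  proof -
    note [measurable] = chain_meas
    show ?thesis unfolding boundary_def mem_Collect_eq by measurable
  qed
  then have bm: "Measurable.pred Pr (\<lambda>\<omega>. chain \<omega> \<in> boundary d)" by (simp add: pred_def)
  have Xm: "X \<in> Pr \<rightarrow>\<^sub>M boundary_borel d"
    unfolding boundary_borel_def
  proof (rule measurable_restrict_space2)
    show "X \<in> space Pr \<rightarrow> boundary d" using Xb by blast
    show "X \<in> Pr \<rightarrow>\<^sub>M borel"
    proof (rule measurable_coordinatewise_then_product)
      fix n
      have "(\<lambda>\<omega>. X \<omega> n) = (\<lambda>\<omega>. if chain \<omega> \<in> boundary d then chain \<omega> n else 1)"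
        by (auto simp: X_def)
      also have "\<dots> \<in> Pr \<rightarrow>\<^sub>M (count_space UNIV :: int measure)"
        using bm chain_meas by (intro measurable_If) (auto simp: pred_def)
      finally show "(\<lambda>\<omega>. X \<omega> n) \<in> Pr \<rightarrow>\<^sub>M borel"
        by (simp add: measurable_cong_sets[OF refl sets_borel_eq_count_space])
    qed
  qed
  define \<nu> where "\<nu> = distr Pr (boundary_borel d) X"
  have \<nu>P: "\<nu> \<in> boundary_probs d"
    unfolding \<nu>_def boundary_probs_def using P.prob_space_distr[OF Xm] by simp
  have \<nu>w: "measure \<nu> (cyl d w) = (\<Prod>k<length w. pmf (K ((0 # w) ! k)) (w ! k))" if w: "set w \<subseteq> letters d" for w
  proof -
    have wI: "(0 # w) ! k \<in> I" if "k < length w" for k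
      proof (cases k)
      case (Suc m)
      then have "w ! m \<in> set w" using that by simp
      with w Suc show ?thesis by (auto simp: I_def)
    qed (simp add: I_def)
    have "emeasure \<nu> (cyl d w) = emeasure Pr (X -` cyl d w \<inter> space Pr)"
      unfolding \<nu>_def by (rule emeasure_distr[OF Xm]) simp
    also have "\<dots> = emeasure Pr {\<omega> \<in> space Pr. \<forall>k\<in>{..<length w}. \<omega> k \<in> {\<phi>. \<phi> ((0 # w) ! k) = w ! k}}"
    proof (rule emeasure_eq_AE)
      show "AE \<omega> in Pr. (\<omega> \<in> X -` cyl d w \<inter> space Pr) =
          (\<omega> \<in> {\<omega> \<in> space Pr. \<forall>k\<in>{..<length w}. \<omega> k \<in> {\<phi>. \<phi> ((0 # w) ! k) = w ! k}})"
        using AEb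
      proof eventually_elim
        case (elim \<omega>)
        then show ?case using chain_eq_iff[of "length w" \<omega> w] by (simp add: X_def cyl_def spPr Ball_def)
      qed
      show "X -` cyl d w \<inter> space Pr \<in> sets Pr" using Xm by (rule measurable_sets) simp
      have "{\<omega> \<in> space Pr. \<omega> k ((0 # w) ! k) = w ! k} \<in> sets Pr" for k
        using measurable_sets[OF comp[of k "(0 # w) ! k"], of "{w ! k}"] by (simp add: vimage_def Int_def conj_commute)
      then show "{\<omega> \<in> space Pr. \<forall>k\<in>{..<length w}. \<omega> k \<in> {\<phi>. \<phi> ((0 # w) ! k) = w ! k}} \<in> sets Pr"
        by (intro sets.sets_Collect_finite_All) auto
    qed
    also have "\<dots> = (\<Prod>k<length w. emeasure (measure_pmf Y) {\<phi>. \<phi> ((0 # w) ! k) = w ! k})"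
      unfolding Pr_def by (rule Pr.emeasure_PiM_Collect) auto
    also have "\<dots> = (\<Prod>k<length w. ennreal (pmf (K ((0 # w) ! k)) (w ! k)))"
      using wI emY by (intro prod.cong) auto
    also have "\<dots> = ennreal (\<Prod>k<length w. pmf (K ((0 # w) ! k)) (w ! k))"
      by (intro prod_ennreal) simp
    finally show ?thesis
      by (simp add: measure_def prod_nonneg)
  qed
  have single: "measure \<nu> (cyl d [a]) = q a / (1 + q a)" if "a \<in> letters d" for a
    using \<nu>w[of "[a]"] that by (simp add: K_def pmfV v_def letters_def)
  have K0: "K 0 = V" by (simp add: K_def letters_def)
  have "measure \<nu> (cyl d (a # w)) = q a * measure \<nu> (cyl d w - cyl d [- a])" if a: "a \<in> letters d" for a w
  proof (cases w)
    case Nil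
    have "0 < 1 + q a" using q0[OF a] by simp
    moreover have "measure \<nu> (cyl d [- a]) = q a / (1 + q a)" using single[of "- a"] a qs[OF a] by simp
    ultimately show ?thesis
      unfolding Nil measure_boundary_diff_cyl[OF \<nu>P] single[OF a] by (simp add: field_simps)
  next
    case (Cons b w')
    show ?thesis
    proof (cases "b = - a")
      case True
      then have "cyl d w - cyl d [- a] = {}" unfolding Cons by (auto simp: mem_cyl_Cons)
      moreover have "cyl d (a # w) = {}" unfolding Cons using True by (rule cyl_empty_inverse)
      ultimately show ?thesis by (simp only: measure_empty mult_zero_right)
    next
      case False
      then have "cyl d w - cyl d [- a] = cyl d w" unfolding Cons by (auto simp: mem_cyl_Cons)
      moreover have "measure \<nu> (cyl d (a # w)) = q a * measure \<nu> (cyl d w)"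
      proof (cases "set w \<subseteq> letters d")
        case True
        have "0 < 1 + q a" using q0[OF a] by simp
        then show ?thesis
          using True a \<nu>w[of "a # w"] \<nu>w[of w] False
          by (simp add: Cons prod.lessThan_Suc_shift K0 pmfV pmfK[OF a False] del: prod.lessThan_Suc)
             (simp add: v_def)
      next
        case False
        then show ?thesis using cyl_empty_letters[of w d] cyl_empty_letters[of "a # w" d] by simp
      qed
      ultimately show ?thesis by simp
    qed
  qed
  then show ?thesis using \<nu>P unfolding conformal_def by blast
qed

section \<open>Entropy\<close>

lemma integral_coord_two_values:
  fixes s t :: real
  assumes M: "M \<in> boundary_probs d"
  shows "integrable M (\<lambda>\<xi>. if \<xi> 0 = j then s else t)"
    and "(\<integral>\<xi>. (if \<xi> 0 = j then s else t) \<partial>M) = t + (s - t) * measure M (cyl d [j])"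
proof -
  interpret prob_space M using boundary_probsD[OF M] by simp
  have cm: "cyl d [j] \<in> sets M" using boundary_probsD[OF M] by simp
  have eq: "(if \<xi> 0 = j then s else t) = t + (s - t) * indicator (cyl d [j]) \<xi>"
    if "\<xi> \<in> space M" for \<xi>
    using that boundary_probsD(3)[OF M] by (simp add: mem_cyl_Cons)
  have int: "integrable M (\<lambda>\<xi>. t + (s - t) * indicator (cyl d [j]) \<xi>)"
    using cm by (intro Bochner_Integration.integrable_add integrable_mult_right integrable_real_indicator)
      (simp_all add: emeasure_eq_measure)
  moreover have "integrable M (\<lambda>\<xi>. if \<xi> 0 = j then s else t) \<longleftrightarrow>
      integrable M (\<lambda>\<xi>. t + (s - t) * indicator (cyl d [j]) \<xi>)"
    by (rule Bochner_Integration.integrable_cong[OF refl]) (rule eq)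
  ultimately show "integrable M (\<lambda>\<xi>. if \<xi> 0 = j then s else t)" by simp
  have "(\<integral>\<xi>. (if \<xi> 0 = j then s else t) \<partial>M) = (\<integral>\<xi>. t + (s - t) * indicator (cyl d [j]) \<xi> \<partial>M)"
    by (rule Bochner_Integration.integral_cong[OF refl]) (rule eq)
  also have "\<dots> = t + (s - t) * measure M (cyl d [j])"
    using cm by (subst Bochner_Integration.integral_add)
      (auto simp: emeasure_eq_measure prob_space intro!: integrable_mult_right integrable_real_indicator)
  finally show "(\<integral>\<xi>. (if \<xi> 0 = j then s else t) \<partial>M) = t + (s - t) * measure M (cyl d [j])" .
qed

text \<open>
  The value of the tangent bound for the divergence of \<open>a\<^sub>j\<nu>\<close> from \<open>\<nu>\<close> at the two-valued density
  \<open>r\<^sub>j\<close>, written in terms of cylinder masses (see \<open>entropy_bound_eq_integrals\<close>).  The last summand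
  is odd under \<open>j \<mapsto> -j\<close> when \<open>q\<close> is symmetric.
\<close>

definition entropy_bound :: "nat \<Rightarrow> (real \<Rightarrow> real) \<Rightarrow> (int \<Rightarrow> real) \<Rightarrow> (nat \<Rightarrow> int) measure \<Rightarrow> int \<Rightarrow> real" where
  "entropy_bound d f q \<nu> j = Psi f (q j)
     - (Psi f (q j) - Psi f (1 / q j)) * measure \<nu> (cyl d [j])
     + (deriv f (1 / q j) - deriv f (q j)) * (measure \<nu> (cyl d [j]) - measure \<nu> (cyl d [- j]))"

context divergence_generator begin

lemma entropy_bound_eq_integrals:
  assumes \<nu>: "\<nu> \<in> boundary_probs d" and j: "j \<in> letters d" and q: "0 < q j"
  defines "r \<equiv> \<lambda>\<xi>. if \<xi> 0 = j then 1 / q j else q j"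
  shows "integrable (translate d [j] \<nu>) (\<lambda>\<xi>. deriv f (r \<xi>))"
    and "integrable \<nu> (\<lambda>\<xi>. f (r \<xi>) - r \<xi> * deriv f (r \<xi>))"
    and "integrable \<nu> (\<lambda>\<xi>. f (r \<xi>))"
    and "(\<integral>\<xi>. deriv f (r \<xi>) \<partial>translate d [j] \<nu>) + (\<integral>\<xi>. f (r \<xi>) - r \<xi> * deriv f (r \<xi>) \<partial>\<nu>)
      = entropy_bound d f q \<nu> j"
proof -
  note t = translate_boundary_probs[OF \<nu> j]
  have if1: "deriv f (r \<xi>) = (if \<xi> 0 = j then deriv f (1 / q j) else deriv f (q j))" for \<xi>
    by (simp add: r_def)
  have if2: "f (r \<xi>) - r \<xi> * deriv f (r \<xi>) = (if \<xi> 0 = j then f (1 / q j) - 1 / q j * deriv f (1 / q j)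
      else f (q j) - q j * deriv f (q j))" for \<xi>
    by (simp add: r_def)
  have if3: "f (r \<xi>) = (if \<xi> 0 = j then f (1 / q j) else f (q j))" for \<xi>
    by (simp add: r_def)
  show "integrable (translate d [j] \<nu>) (\<lambda>\<xi>. deriv f (r \<xi>))"
    unfolding if1 by (rule integral_coord_two_values[OF t])
  show "integrable \<nu> (\<lambda>\<xi>. f (r \<xi>) - r \<xi> * deriv f (r \<xi>))"
    unfolding if2 by (rule integral_coord_two_values[OF \<nu>])
  show "integrable \<nu> (\<lambda>\<xi>. f (r \<xi>))"
    unfolding if3 by (rule integral_coord_two_values[OF \<nu>])
  have "measure (translate d [j] \<nu>) (cyl d [j]) = 1 - measure \<nu> (cyl d [- j])"
    using measure_translate_cyl[OF \<nu> j j, of "[]"] measure_boundary_diff_cyl[OF \<nu>, of "- j"] by simp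
  then have "(\<integral>\<xi>. deriv f (r \<xi>) \<partial>translate d [j] \<nu>) =
      deriv f (q j) + (deriv f (1 / q j) - deriv f (q j)) * (1 - measure \<nu> (cyl d [- j]))"
    unfolding if1 integral_coord_two_values(2)[OF t] by simp
  moreover have "(\<integral>\<xi>. f (r \<xi>) - r \<xi> * deriv f (r \<xi>) \<partial>\<nu>) = f (q j) - q j * deriv f (q j)
      + (f (1 / q j) - 1 / q j * deriv f (1 / q j) - (f (q j) - q j * deriv f (q j))) * measure \<nu> (cyl d [j])"
    unfolding if2 by (rule integral_coord_two_values(2)[OF \<nu>])
  ultimately show "(\<integral>\<xi>. deriv f (r \<xi>) \<partial>translate d [j] \<nu>) + (\<integral>\<xi>. f (r \<xi>) - r \<xi> * deriv f (r \<xi>) \<partial>\<nu>)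
      = entropy_bound d f q \<nu> j"
    using q by (simp add: entropy_bound_def Psi_def algebra_simps)
qed

lemma f_divergence_translate_ge:
  assumes \<nu>: "\<nu> \<in> boundary_probs d" and j: "j \<in> letters d" and q: "0 < q j"
  shows "ereal (entropy_bound d f q \<nu> j) \<le> f_divergence f (translate d [j] \<nu>) \<nu>"
proof -
  note t = translate_boundary_probs[OF \<nu> j]
  note e = entropy_bound_eq_integrals[OF \<nu> j, of q, OF q]
  show ?thesis unfolding e(4)[symmetric]
  proof (rule f_divergence_ge[OF _ _ _ _ _ e(1,2)])
    show "(\<lambda>\<xi>. if \<xi> 0 = j then 1 / q j else q j) \<in> borel_measurable \<nu>"
      using integral_coord_two_values(1)[OF \<nu>] by (rule borel_measurable_integrable)
  qed (use boundary_probsD[OF \<nu>] boundary_probsD[OF t] q in simp_all)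
qed

lemma f_divergence_translate_conformal:
  assumes q: "\<And>j. j \<in> letters d \<Longrightarrow> 0 < q j" "\<And>j. j \<in> letters d \<Longrightarrow> q (- j) = q j"
    and c: "conformal d q \<nu>" and j: "j \<in> letters d"
  shows "f_divergence f (translate d [j] \<nu>) \<nu> = ereal (entropy_bound d f q \<nu> j)"
proof -
  have \<nu>: "\<nu> \<in> boundary_probs d" using c by (simp add: conformal_def)
  note t = translate_boundary_probs[OF \<nu> j]
  note e = entropy_bound_eq_integrals[OF \<nu> j, of q, OF q(1)[OF j]]
  define r where "r \<xi> = (if \<xi> 0 = j then 1 / q j else q j)" for \<xi> :: "nat \<Rightarrow> int"
  note e = e[folded r_def]
  have dens: "translate d [j] \<nu> = density \<nu> (\<lambda>\<xi>. ennreal (r \<xi>))"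
    unfolding r_def using q c j by (rule translate_conformal)
  have r0: "0 < r \<xi>" for \<xi> using q(1)[OF j] by (simp add: r_def)
  have rm: "r \<in> borel_measurable \<nu>"
    unfolding r_def[abs_def] using integral_coord_two_values(1)[OF \<nu>] by (rule borel_measurable_integrable)
  have dm: "(\<lambda>\<xi>. deriv f (r \<xi>)) \<in> borel_measurable \<nu>"
    using borel_measurable_integrable[OF e(1)] unfolding dens by simp
  have ir: "integrable \<nu> (\<lambda>\<xi>. r \<xi> * deriv f (r \<xi>))"
    using e(1) unfolding dens by (subst (asm) integrable_real_density) (use rm dm r0 in \<open>auto intro: less_imp_le\<close>)
  have "f_divergence f (translate d [j] \<nu>) \<nu> = ereal (\<integral>\<xi>. f (r \<xi>) \<partial>\<nu>)"
    using boundary_probsD[OF \<nu>] boundary_probsD[OF t] rm r0 dens e(3)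
    by (intro f_divergence_density) simp_all
  also have "(\<integral>\<xi>. f (r \<xi>) \<partial>\<nu>) = (\<integral>\<xi>. r \<xi> * deriv f (r \<xi>) \<partial>\<nu>) + (\<integral>\<xi>. f (r \<xi>) - r \<xi> * deriv f (r \<xi>) \<partial>\<nu>)"
    using ir e(2,3) by (subst Bochner_Integration.integral_add[symmetric]) simp_all
  also have "(\<integral>\<xi>. r \<xi> * deriv f (r \<xi>) \<partial>\<nu>) = (\<integral>\<xi>. deriv f (r \<xi>) \<partial>translate d [j] \<nu>)"
    unfolding dens by (rule integral_real_density[symmetric]) (use rm dm r0 in \<open>auto intro: less_imp_le\<close>)
  also note e(4)
  finally show ?thesis .
qed

lemma h_entropy_eq_sum:
  assumes "lam \<in> Delta d"
  shows "h_entropy d lam f \<nu> = (\<Sum>j\<in>letters d. ereal (pmf lam [j]) * f_divergence f (translate d [j] \<nu>) \<nu>)"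
proof -
  let ?F = "\<lambda>g. ereal (pmf lam g) * f_divergence f (translate d g \<nu>) \<nu>"
  have "h_entropy d lam f \<nu> = infsum ?F ((\<lambda>i. [i]) ` letters d)"
    unfolding h_entropy_def
  proof (rule infsum_cong_neutral)
    fix g assume "g \<in> carrier (free_grp d) - (\<lambda>i. [i]) ` letters d"
    then have "pmf lam g = 0" using set_pmf_Delta[OF assms] by (auto simp: set_pmf_iff)
    then show "?F g = 0" by (simp flip: zero_ereal_def)
  qed (use letter_carrier in auto)
  also have "\<dots> = sum ?F ((\<lambda>i. [i]) ` letters d)" by (rule infsum_finite) simp
  also have "\<dots> = (\<Sum>j\<in>letters d. ?F [j])" by (subst sum.reindex) (auto simp: inj_on_def)
  finally show ?thesis .
qed

end

lemma sum_letters_uminus: "(\<Sum>j\<in>letters d. g (- j)) = (\<Sum>j\<in>letters d. g j)"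
  by (rule sum.reindex_bij_witness[of _ uminus uminus]) simp_all

text \<open>
  The hypothesis on \<open>c\<close> makes the weighted bound independent of \<open>\<nu>\<close>.
\<close>

lemma sum_entropy_bound:
  assumes \<nu>: "\<nu> \<in> boundary_probs d"
    and l: "\<And>j. j \<in> letters d \<Longrightarrow> l (- j) = l j" and q: "\<And>j. j \<in> letters d \<Longrightarrow> q (- j) = q j"
    and c: "\<And>j. j \<in> letters d \<Longrightarrow> l j * (Psi f (q j) - Psi f (1 / q j)) = c"
  shows "(\<Sum>j\<in>letters d. l j * entropy_bound d f q \<nu> j) = (\<Sum>j\<in>letters d. l j * Psi f (q j)) - c"
proof -
  define m where "m j = measure \<nu> (cyl d [j])" for j
  define e where "e j = l j * (deriv f (1 / q j) - deriv f (q j))" for j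
  have "(\<Sum>j\<in>letters d. e j * m (- j)) = (\<Sum>j\<in>letters d. e (- j) * m (- j))"
    using l q by (intro sum.cong) (simp_all add: e_def)
  also have "\<dots> = (\<Sum>j\<in>letters d. e j * m j)" by (rule sum_letters_uminus)
  finally have e: "(\<Sum>j\<in>letters d. e j * m j - e j * m (- j)) = 0" by (simp add: sum_subtractf)
  have "l j * entropy_bound d f q \<nu> j = l j * Psi f (q j) - c * m j + (e j * m j - e j * m (- j))"
    if "j \<in> letters d" for j
    unfolding c[OF that, symmetric] by (simp add: entropy_bound_def m_def e_def algebra_simps)
  then have "(\<Sum>j\<in>letters d. l j * entropy_bound d f q \<nu> j) =
      (\<Sum>j\<in>letters d. l j * Psi f (q j) - c * m j + (e j * m j - e j * m (- j)))"
    by (rule sum.cong[OF refl])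
  also have "\<dots> = (\<Sum>j\<in>letters d. l j * Psi f (q j)) - c * (\<Sum>j\<in>letters d. m j)"
    by (simp only: sum.distrib sum_subtractf[of "\<lambda>j. l j * Psi f (q j)"] e sum_distrib_left)
  finally show ?thesis using sum_measure_cyl_letters[OF \<nu>] by (simp add: m_def)
qed

lemma sum_letters_abs:
  fixes g :: "int \<Rightarrow> real"
  shows "(\<Sum>j\<in>letters d. g \<bar>j\<bar>) = 2 * (\<Sum>i = 1..int d. g i)"
proof -
  have split: "letters d = {1..int d} \<union> uminus ` {1..int d}"
    by (force simp: letters_def image_iff intro: bexI[of _ "- _"])
  have "(\<Sum>j\<in>uminus ` {1..int d}. g \<bar>j\<bar>) = (\<Sum>i = 1..int d. g i)"
    by (subst sum.reindex) (auto simp: inj_on_def intro!: sum.cong)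
  moreover have "(\<Sum>j\<in>letters d. g \<bar>j\<bar>) =
      (\<Sum>j = 1..int d. g \<bar>j\<bar>) + (\<Sum>j\<in>uminus ` {1..int d}. g \<bar>j\<bar>)"
    unfolding split by (rule sum.union_disjoint) auto
  moreover have "(\<Sum>j = 1..int d. g \<bar>j\<bar>) = (\<Sum>i = 1..int d. g i)" by (rule sum.cong) auto
  ultimately show ?thesis by simp
qed

text \<open>
  The weights in the definition of \<open>T\<close> are nonnegative and add up to one, so \<open>T_map\<close> has
  them as its probabilities.
\<close>

lemma pmf_T_map:
  assumes d: "2 \<le> d" and \<mu>: "\<mu> \<in> Delta d" and "smooth_pos f" "strictly_convex_pos f"
    and j: "j \<in> letters d"
  shows "pmf (T_map d f \<mu>) [j] * (Psi f (hitting d \<mu> j) - Psi f (1 / hitting d \<mu> j)) = T_const d f \<mu>"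
proof -
  interpret divergence_generator f by unfold_locales fact+
  note sol = hitting_solution_hitting[OF d \<mu>]
  have pos: "0 < Psi f (hitting d \<mu> i) - Psi f (1 / hitting d \<mu> i)" if "i \<in> letters d" for i
    using sol that by (intro Psi_diff_pos) (auto simp: hitting_solution_def)
  have absl: "\<bar>i\<bar> \<in> letters d" if "i \<in> letters d" for i using that by (auto simp: letters_def)
  have w0: "0 < T_weight d f \<mu> i" if "i \<in> letters d" for i using pos[OF that] by (simp add: T_weight_def)
  have W: "0 < (\<Sum>i = 1..int d. T_weight d f \<mu> i)"
    using d by (intro sum_pos w0) (auto simp: letters_def)
  then have c0: "0 < T_const d f \<mu>" by (simp add: T_const_def)
  define g where "g w = (if w \<in> (\<lambda>i. [i]) ` letters d
     then T_const d f \<mu> * T_weight d f \<mu> \<bar>hd w\<bar> else 0)" for w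
  have g0: "0 \<le> g w" for w using c0 absl w0 by (auto simp: g_def less_imp_le)
  have "(\<Sum>w\<in>(\<lambda>i. [i]) ` letters d. g w) = (\<Sum>i\<in>letters d. T_const d f \<mu> * T_weight d f \<mu> \<bar>i\<bar>)"
    by (subst sum.reindex) (auto simp: inj_on_def g_def)
  also have "\<dots> = T_const d f \<mu> * (2 * (\<Sum>i = 1..int d. T_weight d f \<mu> i))"
    unfolding sum_distrib_left[symmetric] sum_letters_abs ..
  also have "\<dots> = 1" using W by (simp add: T_const_def)
  finally have sum1: "(\<Sum>w\<in>(\<lambda>i. [i]) ` letters d. g w) = 1" .
  have "(\<integral>\<^sup>+ w. ennreal (g w) \<partial>count_space UNIV) = (\<Sum>w\<in>(\<lambda>i. [i]) ` letters d. ennreal (g w))"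
    by (rule nn_integral_count_space') (auto simp: g_def)
  also have "\<dots> = ennreal (\<Sum>w\<in>(\<lambda>i. [i]) ` letters d. g w)" by (rule sum_ennreal) (rule g0)
  finally have nn1: "(\<integral>\<^sup>+ w. ennreal (g w) \<partial>count_space UNIV) = 1" by (simp add: sum1)
  have "pmf (T_map d f \<mu>) [j] = g [j]"
    unfolding T_map_def g_def[abs_def, symmetric] by (rule pmf_embed_pmf[OF g0 nn1])
  also have "\<dots> = T_const d f \<mu> * T_weight d f \<mu> \<bar>j\<bar>" using j by (simp add: g_def)
  also have "hitting d \<mu> \<bar>j\<bar> = hitting d \<mu> j"
    using hitting_solution_facts(2)[OF d \<mu> sol j] by (simp add: abs_if)
  then have "T_weight d f \<mu> \<bar>j\<bar> = 1 / (Psi f (hitting d \<mu> j) - Psi f (1 / hitting d \<mu> j))"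
    by (simp add: T_weight_def)
  finally show ?thesis using pos[OF j] by simp
qed

theorem theorem4:
  fixes d :: nat and f :: "real \<Rightarrow> real" and lam \<mu> :: "int list pmf"
  assumes "d \<ge> 2"
    and "smooth_pos f" and "strictly_convex_pos f" and "f 1 = 0"
    and "lam \<in> Delta d"
    and "\<mu> \<in> Delta d" and "T_map d f \<mu> = lam"
  shows "I_top d lam f = h_entropy d lam f (harmonic_measure d \<mu>)"
proof -
  interpret divergence_generator f using assms(2,3) by unfold_locales
  note d = \<open>d \<ge> 2\<close> and \<mu> = \<open>\<mu> \<in> Delta d\<close> and lam = \<open>lam \<in> Delta d\<close>
  define q where "q = hitting d \<mu>"
  have sol: "hitting_solution d \<mu> q" unfolding q_def by (rule hitting_solution_hitting[OF d \<mu>])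
  have q0: "0 < q j" if "j \<in> letters d" for j using sol that by (auto simp: hitting_solution_def)
  have qs: "q (- j) = q j" if "j \<in> letters d" for j
    using hitting_solution_facts(2)[OF d \<mu> sol that] .
  obtain \<nu> where cf: "conformal d q \<nu>"
    using conformal_exists[OF q0 qs hitting_solution_sum[OF d \<mu> sol]] by blast
  have \<nu>: "\<nu> \<in> boundary_probs d" using cf by (simp add: conformal_def)
  have st: "stationary d \<mu> \<nu>" by (rule stationary_conformal[OF \<mu> sol cf])
  have harm: "harmonic_measure d \<mu> = \<nu>"
    unfolding harmonic_measure_def using st by (rule the_equality) (rule stationary_unique[OF d \<mu> _ st])
  define E where "E = (\<Sum>j\<in>letters d. pmf lam [j] * Psi f (q j)) - T_const d f \<mu>"
  have sumE: "(\<Sum>j\<in>letters d. pmf lam [j] * entropy_bound d f q \<eta> j) = E"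
    if "\<eta> \<in> boundary_probs d" for \<eta>
    unfolding E_def
    using that pmf_Delta_uminus[OF lam] qs pmf_T_map[OF d \<mu> assms(2,3)] assms(7)
    by (intro sum_entropy_bound) (simp_all add: q_def)
  have "h_entropy d lam f \<nu> = (\<Sum>j\<in>letters d. ereal (pmf lam [j] * entropy_bound d f q \<nu> j))"
    unfolding h_entropy_eq_sum[OF lam]
    using f_divergence_translate_conformal[OF q0 qs cf] by (intro sum.cong) simp_all
  then have hE: "h_entropy d lam f \<nu> = ereal E" using sumE[OF \<nu>] by simp
  have lower: "ereal E \<le> h_entropy d lam f \<eta>" if \<eta>: "\<eta> \<in> boundary_probs d" for \<eta>
  proof -
    have "ereal E = (\<Sum>j\<in>letters d. ereal (pmf lam [j]) * ereal (entropy_bound d f q \<eta> j))"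
      using sumE[OF \<eta>] by simp
    also have "\<dots> \<le> h_entropy d lam f \<eta>"
      unfolding h_entropy_eq_sum[OF lam]
      using f_divergence_translate_ge[OF \<eta>, of _ q] q0
      by (intro sum_mono ereal_mult_left_mono) simp_all
    finally show ?thesis .
  qed
  show ?thesis unfolding I_top_def harm
    using \<nu> lower hE by (intro antisym INF_lower INF_greatest) auto
qed

end
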